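(* Let $S$ be a finite semigroup with commuting idempotents and $K$ a field of characteristic zero. Let $\chi$ be an irreducible character (over $K$) of a maximal subgroup $G$ of $S$ with identity $e$ and let $d$ be the dimension over $K$ of the associated endomorphism division algebra. If $\theta$ is a character of $S$ and $m$ is the multiplicity of the irreducible representation of $S$ associated to $\chi$ as a constituent in $\theta$, then \[md=\sum_{f\in E(S),\,f\le e}(\chi,\theta_f)_G\,\mu(f,e),\] where $\mu$ is the M\"obius function of $E(S)$.
   Context: A semigroup has commuting idempotents if $ef=fe$ for all idempotents $e,f$; then the set $E(S)$ of idempotents is ordered by $f\le e\iff ef=f=fe$. An element $s\in S$ is regular if there is $t\in S$ with $sts=s$ and $tst=t$; such $t$ is unique, written $s^{-1}$. The set $R(S)$ of regular elements is an inverse semigroup. The maximal subgroup of $S$ with identity $e$ is $\{g\in R(S): gg^{-1}=e=g^{-1}g\}$ (the group of units of $eSe$). A character is the trace function of a finite-dimensional matrix representation over $K$. The endomorphism division algebra associated to $\chi$ is $\mathrm{End}_{KG}(V)$ for the simple $KG$-module $V$ affording $\chi$. $\theta_f(s)=\theta(fs)$, and $(\psi,\alpha)_G=\frac1{|G|}\sum_{g\in G}\psi(g^{-1})\alpha(g)$. Irreducible representation of $S$ associated to $\chi$: let $\varphi$ be an irreducible representation of $G$ with character $\chi$. Let $X$ be the set of $f\in E(S)$ for which there is $p_f\in R(S)$ with $p_fp_f^{-1}=e$ and $p_f^{-1}p_f=f$; fix such $p_f$ for each $f\in X$. Let $\varphi^*$ be the irreducible representation of $R(S)$ by $X\times X$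 block matrices whose $(f,f')$ block at $s\in R(S)$ is $\varphi(p_f s p_{f'}^{-1})$ if $f\le ss^{-1}$ and $s^{-1}fs=f'$, and $0$ otherwise. Extend $\varphi^*$ linearly to $KR(S)$. The representation of $S$ associated to $\chi$ is $\varphi^*\circ\nu$, where $\nu:S\to KR(S)$ is the homomorphism $\nu(s)=\sum_{t\in s^\downarrow}\lfloor t\rfloor$, with $s^{\downarrow}=\{u\in R(S): uu^{-1}s=u\}$ and $\lfloor t\rfloor=\sum_{u\le t}\mu_{R(S)}(u,t)\,u$ for $t\in R(S)$; here $u\le t$ in $R(S)$ means $u=et$ for some $e\in E(S)$ and $\mu_{R(S)}$ is the M\"obius function of this order. (It is the unique irreducible representation of $S$ whose restriction to $R(S)$ is $\varphi^*$.) *)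

theory Defs
  imports "Jordan_Normal_Form.VS_Connect"
begin

section \<open>Idempotents, regular elements, maximal subgroups\<close>

definition idems :: "'s::semigroup_mult set" where
  "idems = {e. e * e = e}"

definition regulars :: "'s::semigroup_mult set" where
  "regulars = {s. \<exists>t. s * t * s = s \<and> t * s * t = t}"

text \<open>Meaningful for regular \<open>s\<close> when idempotents commute: only then is the witness unique.\<close>

definition sinv :: "'s::semigroup_mult \<Rightarrow> 's" where
  "sinv s = (THE t. s * t * s = s \<and> t * s * t = t)"

definition max_subgroup :: "'s::semigroup_mult \<Rightarrow> 's set" where
  "max_subgroup e = {g \<in> regulars. g * sinv g = e \<and> sinv g * g = e}"

definition idem_le :: "'s::semigroup_mult \<Rightarrow> 's \<Rightarrow> bool" where
  "idem_le f e \<longleftrightarrow> e * f = f \<and> f * e = f"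

definition reg_le :: "'s::semigroup_mult \<Rightarrow> 's \<Rightarrow> bool" where
  "reg_le u t \<longleftrightarrow> (\<exists>e\<in>idems. u = e * t)"

section \<open>Moebius function of a finite partially ordered set\<close>

text \<open>The guard only serves to make the recursion terminate; the two orders used below satisfy it,
  see \<open>partial_order_idems\<close> and \<open>partial_order_regulars\<close>.\<close>

definition finite_poset :: "'a set \<Rightarrow> ('a \<Rightarrow> 'a \<Rightarrow> bool) \<Rightarrow> bool" where
  "finite_poset A leq \<longleftrightarrow> finite A \<and> (\<forall>x\<in>A. leq x x) \<and>
     (\<forall>x\<in>A. \<forall>y\<in>A. leq x y \<longrightarrow> leq y x \<longrightarrow> x = y) \<and>
     (\<forall>x\<in>A. \<forall>y\<in>A. \<forall>z\<in>A. leq x y \<longrightarrow> leq y z \<longrightarrow> leq x z)"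

function moebius :: "'a set \<Rightarrow> ('a \<Rightarrow> 'a \<Rightarrow> bool) \<Rightarrow> 'a \<Rightarrow> 'a \<Rightarrow> int" where
  "moebius A leq x y =
     (if finite_poset A leq \<and> x \<in> A \<and> y \<in> A \<and> leq x y
      then if x = y then 1
           else - (\<Sum>z\<in>{z\<in>A. leq x z \<and> leq z y \<and> z \<noteq> y}. moebius A leq x z)
      else 0)"
  by pat_completeness auto
termination
proof (relation "measure (\<lambda>(A, leq, x, y). card {z\<in>A. leq x z \<and> leq z y})", simp, goal_cases)
  case (1 A leq x y z)
  then have po: "finite_poset A leq" and mem: "x \<in> A" "y \<in> A" "z \<in> A"
    and le: "leq x y" "leq z y" "z \<noteq> y" by auto
  have "leq w y" if "w \<in> A" "leq w z" for w
    using po mem le that unfolding finite_poset_def by blast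
  moreover have "leq y y" "\<not> leq y z"
    using po mem le unfolding finite_poset_def by blast+
  ultimately have "{w\<in>A. leq x w \<and> leq w z} \<subset> {w\<in>A. leq x w \<and> leq w y}"
    using mem le by blast
  moreover have "finite {w\<in>A. leq x w \<and> leq w y}"
    using po by (simp add: finite_poset_def)
  ultimately show ?case by (simp add: psubset_card_mono)
qed

declare moebius.simps [simp del]

lemma partial_order_idems: "finite_poset (idems :: 's::{semigroup_mult,finite} set) idem_le"
  unfolding finite_poset_def
proof (intro conjI ballI impI)
  fix x y z :: 's assume "idem_le x y" "idem_le y z"
  then have 1: "y * x = x" "x * y = x" "z * y = y" "y * z = y" by (auto simp: idem_le_def)
  have "z * x = x" using 1(1,3) mult.assoc[of z y x] by simp
  moreover have "x * z = x" using 1(2,4) mult.assoc[of x y z] by simp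
  ultimately show "idem_le x z" by (simp add: idem_le_def)
qed (auto simp: idem_le_def idems_def)

lemma partial_order_regulars:
  assumes comm: "\<And>e f :: 's::{semigroup_mult,finite}. e \<in> idems \<Longrightarrow> f \<in> idems \<Longrightarrow> e * f = f * e"
  shows "finite_poset (regulars :: 's set) reg_le"
  unfolding finite_poset_def
proof (intro conjI ballI impI)
  show "finite (regulars :: 's set)" by simp
next
  fix x :: 's assume "x \<in> regulars"
  then obtain t where t: "x * t * x = x" "t * x * t = t" by (auto simp: regulars_def)
  then have "x * t \<in> idems" by (simp add: idems_def mult.assoc)
  then show "reg_le x x" unfolding reg_le_def using t by metis
next
  fix x y :: 's assume "reg_le x y" "reg_le y x"
  then obtain e f where e: "e \<in> idems" "x = e * y" and f: "f \<in> idems" "y = f * x"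
    by (auto simp: reg_le_def)
  have "x = e * (f * x)" using e f by simp
  also have "\<dots> = f * (e * x)" using comm[OF e(1) f(1)] by (metis mult.assoc)
  also have "e * x = x" using e by (metis (mono_tags) idems_def mem_Collect_eq mult.assoc)
  finally show "x = y" using f by simp
next
  fix x y z :: 's assume "reg_le x y" "reg_le y z"
  then obtain e f where e: "e \<in> idems" "x = e * y" and f: "f \<in> idems" "y = f * z"
    by (auto simp: reg_le_def)
  have "(e * f) * (e * f) = e * (f * e) * f" by (simp add: mult.assoc)
  also have "\<dots> = e * (e * f) * f" using comm[OF e(1) f(1)] by simp
  also have "\<dots> = (e * e) * (f * f)" by (simp add: mult.assoc)
  also have "\<dots> = e * f" using e f by (simp add: idems_def)
  finally have "e * f \<in> idems" by (simp add: idems_def)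
  then show "reg_le x z" unfolding reg_le_def using e f by (metis mult.assoc)
qed

section \<open>Matrix representations\<close>

text \<open>A representation of a subsemigroup \<open>A\<close>; the degree \<open>n\<close> may be \<open>0\<close>, and no element is
  required to act as the identity matrix.\<close>

definition mat_rep :: "'s::semigroup_mult set \<Rightarrow> nat \<Rightarrow> ('s \<Rightarrow> 'k::field mat) \<Rightarrow> bool" where
  "mat_rep A n \<rho> \<longleftrightarrow> (\<forall>s\<in>A. \<rho> s \<in> carrier_mat n n) \<and> (\<forall>s\<in>A. \<forall>t\<in>A. \<rho> (s * t) = \<rho> s * \<rho> t)"

text \<open>The null representation of degree \<open>1\<close> is not excluded: it can occur as a composition
  factor.\<close>

definition irreducible_rep :: "'s::semigroup_mult set \<Rightarrow> nat \<Rightarrow> ('s \<Rightarrow> 'k::field mat) \<Rightarrow> bool" where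
  "irreducible_rep A n \<rho> \<longleftrightarrow> mat_rep A n \<rho> \<and> n > 0 \<and>
     (\<forall>W. subspace class_ring W (module_vec TYPE('k) n) \<longrightarrow>
          (\<forall>s\<in>A. \<forall>w\<in>W. \<rho> s *\<^sub>v w \<in> W) \<longrightarrow> W = {0\<^sub>v n} \<or> W = carrier_vec n)"

text \<open>A group acts by invertible matrices, so its identity \<open>e\<close> acts as the identity matrix.\<close>

definition irreducible_group_rep :: "'s::semigroup_mult \<Rightarrow> nat \<Rightarrow> ('s \<Rightarrow> 'k::field mat) \<Rightarrow> bool" where
  "irreducible_group_rep e n \<phi> \<longleftrightarrow> irreducible_rep (max_subgroup e) n \<phi> \<and> \<phi> e = 1\<^sub>m n"

definition equivalent_reps ::
    "'s::semigroup_mult set \<Rightarrow> ('s \<Rightarrow> 'k::field mat) \<Rightarrow> ('s \<Rightarrow> 'k mat) \<Rightarrow> bool" where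
  "equivalent_reps A \<rho> \<sigma> \<longleftrightarrow> (\<exists>P Q. \<forall>s\<in>A. similar_mat_wit (\<rho> s) (\<sigma> s) P Q)"

definition mat_trace :: "'k::field mat \<Rightarrow> 'k" where
  "mat_trace M = (\<Sum>i<dim_row M. M $$ (i, i))"

definition is_character :: "('s::semigroup_mult \<Rightarrow> 'k::field) \<Rightarrow> bool" where
  "is_character \<theta> \<longleftrightarrow> (\<exists>n \<rho>. mat_rep UNIV n \<rho> \<and> (\<forall>s. \<theta> s = mat_trace (\<rho> s)))"

text \<open>\<open>composition_factors n \<rho> \<sigma>s\<close>: in a basis adapted to some composition series of \<open>\<rho>\<close>, the
  matrices of \<open>\<rho>\<close> are block upper triangular with the irreducible representations \<open>\<sigma>s\<close>, the
  successive factors of the series, down the diagonal.\<close>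

inductive composition_factors ::
    "nat \<Rightarrow> ('s::semigroup_mult \<Rightarrow> 'k::field mat) \<Rightarrow> ('s \<Rightarrow> 'k mat) list \<Rightarrow> bool" where
  Nil: "mat_rep UNIV 0 \<rho> \<Longrightarrow> composition_factors 0 \<rho> []"
| Cons: "mat_rep UNIV (k + l) \<rho> \<Longrightarrow> irreducible_rep UNIV k \<sigma> \<Longrightarrow> composition_factors l \<tau> \<sigma>s \<Longrightarrow>
     (\<And>s. \<beta> s \<in> carrier_mat k l) \<Longrightarrow>
     equivalent_reps UNIV \<rho> (\<lambda>s. four_block_mat (\<sigma> s) (\<beta> s) (0\<^sub>m l k) (\<tau> s)) \<Longrightarrow>
     composition_factors (k + l) \<rho> (\<sigma> # \<sigma>s)"

text \<open>\<open>m\<close> is the multiplicity of \<open>\<sigma>\<close> as a constituent in (a representation affording) \<open>\<theta>\<close>.\<close>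

definition is_multiplicity ::
    "('s::semigroup_mult \<Rightarrow> 'k::field mat) \<Rightarrow> ('s \<Rightarrow> 'k) \<Rightarrow> nat \<Rightarrow> bool" where
  "is_multiplicity \<sigma> \<theta> m \<longleftrightarrow>
     (\<exists>n \<rho> \<sigma>s. mat_rep UNIV n \<rho> \<and> (\<forall>s. \<theta> s = mat_trace (\<rho> s)) \<and>
        composition_factors n \<rho> \<sigma>s \<and> m = length (filter (equivalent_reps UNIV \<sigma>) \<sigma>s))"

text \<open>Dimension over \<open>K\<close> of \<open>End\<^bsub>KG\<^esub>(V)\<close>, where \<open>V = K\<^sup>n\<close> is the module of column vectors on which
  \<open>G\<close> acts through \<open>\<phi>\<close>; endomorphisms are identified with their matrices.\<close>

definition endo_dim :: "'s::semigroup_mult set \<Rightarrow> nat \<Rightarrow> ('s \<Rightarrow> 'k::field mat) \<Rightarrow> nat" where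
  "endo_dim G n \<phi> = vectorspace.dim class_ring
     (module_mat TYPE('k) n n \<lparr>carrier := {M \<in> carrier_mat n n. \<forall>g\<in>G. M * \<phi> g = \<phi> g * M}\<rparr>)"

definition char_inner ::
    "'s::semigroup_mult set \<Rightarrow> ('s \<Rightarrow> 'k::field) \<Rightarrow> ('s \<Rightarrow> 'k) \<Rightarrow> 'k" where
  "char_inner G \<psi> \<alpha> = (\<Sum>g\<in>G. \<psi> (sinv g) * \<alpha> g) / of_nat (card G)"

section \<open>The irreducible representation of \<open>S\<close> associated to \<open>\<chi>\<close>\<close>

definition index_idems :: "'s::semigroup_mult \<Rightarrow> 's set" where
  "index_idems e = {f \<in> idems. \<exists>p\<in>regulars. p * sinv p = e \<and> sinv p * p = f}"

text \<open>The representation \<open>\<phi>\<^sup>*\<close> of \<open>R(S)\<close>. The rows and columns of the \<open>X \<times> X\<close> block matrix are ordered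
  by a list \<open>fs\<close> enumerating \<open>X\<close>; \<open>p\<close> is the choice function.\<close>

definition phi_star ::
    "nat \<Rightarrow> ('s::semigroup_mult \<Rightarrow> 'k::field mat) \<Rightarrow> ('s \<Rightarrow> 's) \<Rightarrow> 's list \<Rightarrow> 's \<Rightarrow> 'k mat" where
  "phi_star n \<phi> p fs s =
     mat (length fs * n) (length fs * n) (\<lambda>(i, j).
       let f = fs ! (i div n); f' = fs ! (j div n) in
       if idem_le f (s * sinv s) \<and> sinv s * f * s = f'
       then \<phi> (p f * s * sinv (p f')) $$ (i mod n, j mod n) else 0)"

text \<open>An element of \<open>KR(S)\<close> is a function \<open>S \<Rightarrow> K\<close> vanishing off \<open>R(S)\<close>.\<close>

definition linear_ext ::
    "nat \<Rightarrow> ('s::semigroup_mult \<Rightarrow> 'k::field mat) \<Rightarrow> ('s \<Rightarrow> 'k) \<Rightarrow> 'k mat" where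
  "linear_ext n \<rho> a = mat n n (\<lambda>ij. \<Sum>u\<in>regulars. a u * \<rho> u $$ ij)"

definition floor_elt :: "'s::semigroup_mult \<Rightarrow> 's \<Rightarrow> 'k::field" where
  "floor_elt t = (\<lambda>u. if u \<in> regulars \<and> reg_le u t then of_int (moebius regulars reg_le u t) else 0)"

definition down_set :: "'s::semigroup_mult \<Rightarrow> 's set" where
  "down_set s = {u \<in> regulars. u * sinv u * s = u}"

definition nu :: "'s::semigroup_mult \<Rightarrow> 's \<Rightarrow> 'k::field" where
  "nu s = (\<lambda>u. \<Sum>t\<in>down_set s. floor_elt t u)"

definition assoc_rep ::
    "nat \<Rightarrow> ('s::semigroup_mult \<Rightarrow> 'k::field mat) \<Rightarrow> ('s \<Rightarrow> 's) \<Rightarrow> 's list \<Rightarrow> 's \<Rightarrow> 'k mat" where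
  "assoc_rep n \<phi> p fs s = linear_ext (length fs * n) (phi_star n \<phi> p fs) (nu s)"

end

theory Submission
  imports Defs
begin

text \<open>
  Put \<open>\<eta> = (\<Sum>f \<le> e. \<mu>(f,e) f)\<close> in the semigroup algebra. Moebius inversion in the meet semilattice of
  idempotents shows that \<open>\<eta>\<close> is an idempotent with \<open>\<eta>e = \<eta>\<close>, that \<open>\<eta>h = 0 = h\<eta>\<close> for every idempotent \<open>h\<close>
  that does not lie above \<open>e\<close>, and that \<open>\<eta>\<close> commutes with the maximal subgroup \<open>G\<close>
  (\<open>eta_kill\<close>, \<open>eta_idem\<close>, \<open>eta_commutes\<close>). So if \<open>\<theta>\<close> is afforded by \<open>V\<close>, then \<open>G\<close> acts on \<open>\<eta>V\<close>, and the
  right-hand side of the theorem, called \<open>moebius_pairing \<chi> \<theta>\<close> below, is the inner product of \<open>\<chi>\<close> with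
  the character of \<open>\<eta>V\<close>; it is the dimension of \<open>Hom\<^sub>G(V\<^sub>\<phi>, \<eta>V)\<close>. It is additive along composition
  series, so it suffices to see that on the character of an irreducible \<open>\<sigma>\<close> it takes the value \<open>d\<close> if
  \<open>\<sigma>\<close> is equivalent to the associated representation, and \<open>0\<close> otherwise.

  The bridge is a closed formula for the associated representation: at an arbitrary \<open>s\<close>, regular or
  not, its \<open>(f,f')\<close> block is \<open>\<phi>(p\<^sub>f s p\<^sub>f\<^sub>'\<inverse>)\<close> if this product lies in \<open>G\<close>, and \<open>0\<close> otherwise
  (\<open>sum_nu_block_entry\<close>, \<open>assoc_rep_entry\<close>). The two summations in \<open>\<nu>\<close> collapse by Moebius inversion in
  the natural order of the regular elements.

  Suppose the value on an irreducible \<open>\<sigma>\<close> is not \<open>0\<close>. Averaging over \<open>G\<close> produces a nonzero \<open>G\<close>-map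
  \<open>X: V\<^sub>\<phi> \<rightarrow> \<eta>V\<close>. As \<open>S\<close> is finite and \<open>\<sigma>\<close> irreducible with \<open>\<sigma>(\<eta>) \<noteq> 0\<close>, the matrix \<open>\<sigma>(\<eta>b)\<close> vanishes for all
  \<open>b \<in> eSe\<close> outside \<open>G\<close> (\<open>eta_kill_nonunit\<close>), and hence \<open>\<sigma>(y\<eta>)\<close> vanishes for all \<open>y \<in> Se\<close> outside the Green
  class \<open>L\<close> of \<open>e\<close> (\<open>kill_eta_outside_L_class\<close>). Now \<open>L\<close> is the disjoint union of the cosets
  \<open>p\<^sub>f\<inverse>G\<close>, so, by the closed formula, the block row with entries \<open>\<sigma>(p\<^sub>f\<inverse>)X\<close> intertwines the associated
  representation with \<open>\<sigma>\<close>. It is injective because \<open>\<sigma>(\<eta>p\<^sub>f)\<close> singles out the block of \<open>f\<close> and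
  \<open>X\<close> is injective, and surjective because its image is invariant.

  Conversely, by the closed formula \<open>\<eta>\<close> acts in the associated representation as the projection onto the
  block of \<open>e\<close>, where \<open>G\<close> acts by a conjugate of \<open>\<phi>\<close>. The value there is therefore \<open>(\<chi>,\<chi>)\<^sub>G\<close>, which is the
  trace of the averaging projection of all matrices onto those commuting with \<open>\<phi>\<close>, that is \<open>d\<close>
  (\<open>endo_dim_eq\<close>).
\<close>

section \<open>Matrices, subspaces and traces\<close>

text \<open>Associativity with conditions on dimensions only, so that the simplifier can check them.\<close>

lemma mat_mult_assoc:
  fixes A B C :: "'k::semiring_0 mat"
  assumes "dim_col A = dim_row B" "dim_col B = dim_row C"
  shows "A * B * C = A * (B * C)"
  by (rule assoc_mult_mat[of A "dim_row A" "dim_row B" B "dim_row C" C "dim_col C"])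
    (use assms in \<open>auto intro: carrier_matI\<close>)

lemma mat_mult_entry:
  assumes "A \<in> carrier_mat r k" "B \<in> carrier_mat k c" "i < r" "j < c"
  shows "(A * B) $$ (i, j) = (\<Sum>x<k. A $$ (i, x) * B $$ (x, j))"
  using assms by (simp add: scalar_prod_def lessThan_atLeast0)

lemma mult_zero_vec:
  fixes A :: "'k::semiring_0 mat"
  assumes "A \<in> carrier_mat r c" shows "A *\<^sub>v 0\<^sub>v c = 0\<^sub>v r"
  using assms by (intro eq_vecI) auto

lemma subspaceI_vec:
  fixes W :: "'k::field vec set"
  assumes "W \<subseteq> carrier_vec n" "0\<^sub>v n \<in> W"
    and "\<And>v w. v \<in> W \<Longrightarrow> w \<in> W \<Longrightarrow> v + w \<in> W"
    and "\<And>c v. v \<in> W \<Longrightarrow> c \<cdot>\<^sub>v v \<in> W"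
  shows "subspace class_ring W (module_vec TYPE('k) n)"
  unfolding subspace_def submodule_def
  using assms vec_vs[of n, where 'a='k] vec_module[of n, where 'a='k]
  by (auto simp: module_vec_simps)

lemma subspaceI_mat:
  fixes D :: "'k::field mat set"
  assumes "D \<subseteq> carrier_mat r c" "0\<^sub>m r c \<in> D"
    and "\<And>A B. A \<in> D \<Longrightarrow> B \<in> D \<Longrightarrow> A + B \<in> D"
    and "\<And>a A. A \<in> D \<Longrightarrow> a \<cdot>\<^sub>m A \<in> D"
  shows "subspace class_ring D (module_mat TYPE('k) r c)"
  unfolding subspace_def submodule_def
  using assms matrix_vs[of r c, where 'a='k]
  by (auto simp: matrix_vs_simps vectorspace_def)

lemma subspace_kernel:
  fixes M :: "'k::field mat"
  assumes M: "M \<in> carrier_mat r n"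
  shows "subspace class_ring {v \<in> carrier_vec n. M *\<^sub>v v = 0\<^sub>v r} (module_vec TYPE('k) n)"
  by (rule subspaceI_vec)
    (use M in \<open>auto simp: mult_add_distrib_mat_vec mult_mat_vec\<close>)

lemma subspace_image:
  fixes M :: "'k::field mat"
  assumes M: "M \<in> carrier_mat r n"
  shows "subspace class_ring {M *\<^sub>v v | v. v \<in> carrier_vec n} (module_vec TYPE('k) r)"
proof (rule subspaceI_vec, goal_cases)
  case 1 show ?case using M by auto
next
  case 2 show ?case using M by (auto intro!: exI[of _ "0\<^sub>v n"])
next
  case (3 v w) then show ?case using mult_add_distrib_mat_vec[OF M] by (auto, metis add_carrier_vec)
next
  case (4 c v) then show ?case using mult_mat_vec[OF M] by (auto, metis smult_carrier_vec)
qed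

lemma mat_eq_0_if_kills_vecs:
  fixes M :: "'k::field mat"
  assumes M: "M \<in> carrier_mat r n" and z: "\<And>v. v \<in> carrier_vec n \<Longrightarrow> M *\<^sub>v v = 0\<^sub>v r"
  shows "M = 0\<^sub>m r n"
proof (rule eq_matI)
  fix i j assume "i < dim_row (0\<^sub>m r n :: 'k mat)" "j < dim_col (0\<^sub>m r n :: 'k mat)"
  then have ij: "i < r" "j < n" by simp_all
  have "M $$ (i, j) = (M *\<^sub>v unit_vec n j) $ i" using M ij by simp
  then show "M $$ (i, j) = 0\<^sub>m r n $$ (i, j)" using z ij by simp
qed (use M in auto)

lemma trace_mult_commute:
  fixes A B :: "'k::field mat"
  assumes A: "A \<in> carrier_mat r c" and B: "B \<in> carrier_mat c r"
  shows "mat_trace (A * B) = mat_trace (B * A)"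
proof -
  have "mat_trace (A * B) = (\<Sum>i<r. \<Sum>j<c. A $$ (i,j) * B $$ (j,i))"
    using A B by (simp add: mat_trace_def scalar_prod_def lessThan_atLeast0)
  also have "\<dots> = (\<Sum>j<c. \<Sum>i<r. A $$ (i,j) * B $$ (j,i))" by (rule sum.swap)
  also have "\<dots> = mat_trace (B * A)"
    using A B by (simp add: mat_trace_def scalar_prod_def lessThan_atLeast0 mult.commute)
  finally show ?thesis .
qed

lemma trace_similar:
  assumes "similar_mat_wit A B P Q"
  shows "mat_trace A = mat_trace (B :: 'k::field mat)"
proof -
  from similar_mat_witD[OF refl assms]
  obtain n where *: "A = P * B * Q" "B \<in> carrier_mat n n" "P \<in> carrier_mat n n" "Q \<in> carrier_mat n n"
    "Q * P = 1\<^sub>m n" by blast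
  have "mat_trace A = mat_trace (Q * (P * B))"
    unfolding *(1) using * by (intro trace_mult_commute[of _ n n]) auto
  also have "Q * (P * B) = B" using * by (simp flip: assoc_mult_mat[of Q n n P n B n])
  finally show ?thesis .
qed

lemma trace_four_block:
  fixes A D :: "'k::field mat"
  assumes "A \<in> carrier_mat k k" "D \<in> carrier_mat l l"
  shows "mat_trace (four_block_mat A B C D) = mat_trace A + mat_trace D"
proof -
  have *: "(\<Sum>i<k+l. if i < k then A $$ (i,i) else D $$ (i-k,i-k)) = (\<Sum>i<k. A $$ (i,i)) + (\<Sum>i<l. D $$ (i,i))"
    by (induct l) auto
  have "mat_trace (four_block_mat A B C D) = (\<Sum>i<k+l. if i < k then A $$ (i,i) else D $$ (i-k,i-k))"
    using assms unfolding mat_trace_def by (auto intro!: sum.cong)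
  then show ?thesis using * assms by (simp add: mat_trace_def)
qed

text \<open>\<open>P i j\<close> stands for the image of the matrix unit at \<open>(i, j)\<close> under a linear map into \<open>D\<close> that fixes
  \<open>D\<close> pointwise. Such a map is a projection onto \<open>D\<close>, its trace is the sum on the right, and the trace
  of a projection is the dimension of its image.\<close>

lemma dim_eq_trace_of_projection:
  fixes D :: "'k::field mat set" and P :: "nat \<Rightarrow> nat \<Rightarrow> 'k mat"
  assumes sub: "subspace class_ring D (module_mat TYPE('k) r c)"
    and PD: "\<And>i j. i < r \<Longrightarrow> j < c \<Longrightarrow> P i j \<in> D"
    and fixes_D: "\<And>M a b. M \<in> D \<Longrightarrow> a < r \<Longrightarrow> b < c \<Longrightarrow>
        M $$ (a, b) = (\<Sum>i<r. \<Sum>j<c. M $$ (i, j) * P i j $$ (a, b))"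
  shows "of_nat (vectorspace.dim class_ring (module_mat TYPE('k) r c \<lparr>carrier := D\<rparr>)) =
    (\<Sum>i<r. \<Sum>j<c. P i j $$ (i, j))"
proof -
  let ?V = "module_mat TYPE('k) r c \<lparr>carrier := D\<rparr>"
  interpret M: vectorspace class_ring "module_mat TYPE('k) r c" by (rule matrix_vs)
  interpret V: vectorspace class_ring ?V using M.subspace_is_vs[OF sub] by simp
  have DM: "D \<subseteq> carrier_mat r c"
    using sub by (auto simp: subspace_def submodule_def module_mat_simps)
  have D_dim: "dim_row A = r" "dim_col A = c" if "A \<in> D" for A using that DM by auto
  have ops: "carrier ?V = D" "\<And>A B. A \<oplus>\<^bsub>?V\<^esub> B = A + B" "\<And>a A. a \<odot>\<^bsub>?V\<^esub> A = a \<cdot>\<^sub>m A" "\<zero>\<^bsub>?V\<^esub> = 0\<^sub>m r c"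
    by (simp_all add: module_mat_def)
  note ops = ops module_mat_simps
  have finsum_entry: "finsum ?V f A $$ (a, b) = (\<Sum>x\<in>A. f x $$ (a, b))"
    if "finite A" "f \<in> A \<rightarrow> D" "a < r" "b < c" for f :: "'i \<Rightarrow> 'k mat" and A a b
    using that
  proof (induct A rule: finite_induct)
    case empty then show ?case by (simp add: ops(4))
  next
    case (insert x A)
    then have c: "f \<in> A \<rightarrow> carrier ?V" "f x \<in> carrier ?V" by (auto simp: ops)
    have "finsum ?V f A \<in> D" using V.finsum_closed[OF c(1)] by (simp add: ops)
    then show ?case using insert c DM
      by (subst V.finsum_insert) (auto simp: ops module_mat_simps)
  qed
  let ?I = "{..<r} \<times> {..<c}"
  have smD: "a \<cdot>\<^sub>m A \<in> D" if "A \<in> D" for a A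
    using V.smult_closed[of a A] that by (simp add: ops)
  have sm_ix: "(x \<cdot>\<^sub>m A) $$ (a, b) = x * A $$ (a, b)" if "A \<in> D" "a < r" "b < c" for x A a b
    using that by (simp add: D_dim)
  have eqD: "A = B" if "A \<in> D" "B \<in> D" "\<And>a b. a < r \<Longrightarrow> b < c \<Longrightarrow> A $$ (a,b) = B $$ (a,b)" for A B
    using that by (intro eq_matI) (auto simp: D_dim)
  have expand: "A = finsum ?V (\<lambda>(i,j). A $$ (i,j) \<cdot>\<^sub>m P i j) ?I" if "A \<in> D" for A
  proof (rule eqD[OF that])
    have f: "(\<lambda>(i,j). A $$ (i,j) \<cdot>\<^sub>m P i j) \<in> ?I \<rightarrow> D" by (auto intro!: smD PD)
    then show "finsum ?V (\<lambda>(i,j). A $$ (i,j) \<cdot>\<^sub>m P i j) ?I \<in> D"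
      using V.finsum_closed[of "(\<lambda>(i,j). A $$ (i,j) \<cdot>\<^sub>m P i j)" ?I] by (simp add: ops)
    show "A $$ (a,b) = finsum ?V (\<lambda>(i,j). A $$ (i,j) \<cdot>\<^sub>m P i j) ?I $$ (a,b)" if "a < r" "b < c" for a b
      using fixes_D[OF \<open>A \<in> D\<close> that] that finsum_entry[OF _ f that] PD
      by (simp add: sum.cartesian_product) (auto intro!: sum.cong simp: sm_ix)
  qed
  have "V.fin_dim"
    unfolding V.fin_dim_def
  proof (intro exI conjI)
    let ?A = "(\<lambda>(i,j). P i j) ` ?I"
    show "finite ?A" by simp
    show A: "?A \<subseteq> carrier ?V" using PD by (auto simp: ops)
    have S: "submodule class_ring (V.span ?A) ?V" by (rule V.span_is_submodule[OF A])
    then interpret S: submodule class_ring "V.span ?A" ?V .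
    have "A \<in> V.span ?A" if "A \<in> D" for A
    proof -
      have "finsum ?V (\<lambda>(i,j). A $$ (i,j) \<cdot>\<^sub>m P i j) J \<in> V.span ?A" if "J \<subseteq> ?I" for J
        using finite_subset[OF that finite_cartesian_product[OF finite_lessThan finite_lessThan]] that
      proof (induct J rule: finite_induct)
        case empty then show ?case using S by (simp add: submodule_def)
      next
        case (insert x J)
        have "(\<lambda>(i,j). A $$ (i,j) \<cdot>\<^sub>m P i j) \<in> J \<rightarrow> carrier ?V"
          "(case x of (i,j) \<Rightarrow> A $$ (i,j) \<cdot>\<^sub>m P i j) \<in> carrier ?V"
          using insert by (auto simp: ops intro!: smD PD)
        moreover have "(case x of (i,j) \<Rightarrow> P i j) \<in> V.span ?A"
          using V.in_own_span[OF A] insert by auto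
        then have "(case x of (i,j) \<Rightarrow> A $$ (i,j) \<cdot>\<^sub>m P i j) \<in> V.span ?A"
          using S.smult_closed[of "A $$ x"] by (auto simp: ops split: prod.splits)
        ultimately show ?case using insert S.m_closed by (simp add: V.finsum_insert)
      qed
      from this[of ?I] show ?thesis using expand[OF that] by simp
    qed
    then show "V.gen_set ?A" using V.span_is_subset2[OF A] by (auto simp: ops)
  qed
  then obtain B where B: "finite B" "V.basis B" using V.finite_basis_exists by blast
  have BD: "B \<subseteq> D" using B by (auto simp: V.basis_def ops)
  have lin: "V.lincomb a B $$ (x,y) = (\<Sum>b\<in>B. a b * b $$ (x,y))" if "x < r" "y < c" for a x y
    unfolding V.lincomb_def using that B BD
    by (subst finsum_entry) (auto simp: ops sm_ix subset_iff intro!: smD sum.cong)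
  have lin_D: "V.lincomb a B \<in> D" for a
    using V.lincomb_closed[of B a] BD by (simp add: ops)
  have "\<exists>a. A = V.lincomb a B" if "A \<in> D" for A
    using that B V.finite_in_span[of B A] by (auto simp: V.basis_def ops)
  then obtain co where co: "\<And>A. A \<in> D \<Longrightarrow> A = V.lincomb (co A) B" by metis
  have Pco: "P i j $$ (x,y) = (\<Sum>b\<in>B. co (P i j) b * b $$ (x,y))"
    if "i < r" "j < c" "x < r" "y < c" for i j x y
    by (rule trans[OF arg_cong[OF co[OF PD[OF that(1,2)]], of "\<lambda>A. A $$ (x,y)"] lin[OF that(3,4)]])
  have indep: "a b = 0" if "\<And>x y. x < r \<Longrightarrow> y < c \<Longrightarrow> (\<Sum>b\<in>B. a b * b $$ (x,y)) = 0" "b \<in> B" for a b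
  proof -
    have "V.lincomb a B = 0\<^sub>m r c"
      using that lin lin_D[of a] by (intro eq_matI) (auto simp: D_dim)
    then show ?thesis
      using B that(2) V.lin_dep_crit[of B B a b] by (auto simp: V.basis_def ops)
  qed
  \<comment> \<open>The functional \<open>M \<mapsto> (\<Sum>i j. M(i,j) * co (P i j) b)\<close> is the \<open>b\<close>-coordinate of the projection of \<open>M\<close>, so it
    takes the value 1 at \<open>b\<close>; adding these values over the basis gives the trace.\<close>
  have dual: "(\<Sum>i<r. \<Sum>j<c. b $$ (i,j) * co (P i j) b) = 1" if b: "b \<in> B" for b
  proof -
    define a where "a b' = (\<Sum>i<r. \<Sum>j<c. b $$ (i,j) * co (P i j) b') - (if b' = b then 1 else 0)" for b'
    have "a b = 0"
    proof (rule indep[OF _ b])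
      fix x y assume xy: "x < r" "y < c"
      have "b $$ (x,y) = (\<Sum>i<r. \<Sum>j<c. b $$ (i,j) * P i j $$ (x,y))"
        using fixes_D b BD xy by blast
      also have "\<dots> = (\<Sum>i<r. \<Sum>j<c. b $$ (i,j) * (\<Sum>b'\<in>B. co (P i j) b' * b' $$ (x,y)))"
        using Pco xy by (intro sum.cong refl arg_cong2[where f="(*)"]) simp
      also have "\<dots> = (\<Sum>i<r. \<Sum>j<c. \<Sum>b'\<in>B. b $$ (i,j) * co (P i j) b' * b' $$ (x,y))"
        by (simp add: sum_distrib_left mult.assoc)
      also have "\<dots> = (\<Sum>i<r. \<Sum>b'\<in>B. \<Sum>j<c. b $$ (i,j) * co (P i j) b' * b' $$ (x,y))"
        by (intro sum.cong refl sum.swap)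
      also have "\<dots> = (\<Sum>b'\<in>B. \<Sum>i<r. \<Sum>j<c. b $$ (i,j) * co (P i j) b' * b' $$ (x,y))"
        by (rule sum.swap)
      finally have 1: "(\<Sum>b'\<in>B. (\<Sum>i<r. \<Sum>j<c. b $$ (i,j) * co (P i j) b') * b' $$ (x,y)) = b $$ (x,y)"
        by (simp add: sum_distrib_right)
      have 2: "(\<Sum>b'\<in>B. (if b' = b then 1 else 0) * b' $$ (x,y)) = b $$ (x,y)"
        using B b by (simp add: if_distrib if_distribR sum.delta cong: if_cong)
      show "(\<Sum>b'\<in>B. a b' * b' $$ (x,y)) = 0"
        unfolding a_def left_diff_distrib sum_subtractf 1 2 by simp
    qed
    then show ?thesis by (simp add: a_def)
  qed
  have "(\<Sum>i<r. \<Sum>j<c. P i j $$ (i,j)) = (\<Sum>i<r. \<Sum>j<c. \<Sum>b\<in>B. co (P i j) b * b $$ (i,j))"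
    using Pco by (intro sum.cong refl) simp
  also have "\<dots> = (\<Sum>i<r. \<Sum>b\<in>B. \<Sum>j<c. co (P i j) b * b $$ (i,j))"
    by (intro sum.cong refl sum.swap)
  also have "\<dots> = (\<Sum>b\<in>B. \<Sum>i<r. \<Sum>j<c. co (P i j) b * b $$ (i,j))" by (rule sum.swap)
  also have "\<dots> = (\<Sum>b\<in>B. 1)" using dual by (simp add: mult.commute)
  finally show ?thesis using V.dim_basis[OF B] by simp
qed

text \<open>The inverse is obtained column by column; comparing the traces of the two products then gives the
  equality of the dimensions, since the characteristic is zero.\<close>

lemma inverse_of_bijective_mat:
  fixes T :: "'k::field_char_0 mat"
  assumes T: "T \<in> carrier_mat k m"
    and inj: "\<And>v. v \<in> carrier_vec m \<Longrightarrow> T *\<^sub>v v = 0\<^sub>v k \<Longrightarrow> v = 0\<^sub>v m"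
    and surj: "\<And>w. w \<in> carrier_vec k \<Longrightarrow> \<exists>v\<in>carrier_vec m. T *\<^sub>v v = w"
  obtains R where "k = m" "R \<in> carrier_mat m k" "T * R = 1\<^sub>m k" "R * T = 1\<^sub>m m"
proof -
  obtain r where r: "\<And>i. i < k \<Longrightarrow> r i \<in> carrier_vec m \<and> T *\<^sub>v r i = unit_vec k i"
    using surj[OF unit_vec_carrier] by metis
  define R where "R = mat_of_cols m (map r [0..<k])"
  have R: "R \<in> carrier_mat m k" by (intro carrier_matI) (simp_all add: R_def)
  have colR: "col R i = r i" if "i < k" for i using that r by (simp add: R_def)
  have TR: "T * R = 1\<^sub>m k"
  proof (rule eq_matI)
    fix i j assume "i < dim_row (1\<^sub>m k :: 'k mat)" "j < dim_col (1\<^sub>m k :: 'k mat)"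
    then have ij: "i < k" "j < k" by auto
    have "(T * R) $$ (i, j) = (T *\<^sub>v r j) $ i" using ij T R colR by simp
    then show "(T * R) $$ (i, j) = 1\<^sub>m k $$ (i, j)" using r ij by simp
  qed (use T R in auto)
  have injD: "a = b" if a: "a \<in> carrier_vec m" and b: "b \<in> carrier_vec m" and "T *\<^sub>v a = T *\<^sub>v b" for a b
  proof -
    have "T *\<^sub>v (a - b) = T *\<^sub>v a - T *\<^sub>v b" by (rule mult_minus_distrib_mat_vec[OF T a b])
    also have "\<dots> = 0\<^sub>v k" unfolding that(3) by (rule minus_cancel_vec[OF mult_mat_vec_carrier[OF T b]])
    finally have d: "a - b = 0\<^sub>v m" using inj a b by simp
    show "a = b"
    proof (rule eq_vecI)
      fix i assume i: "i < dim_vec b"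
      have "a $ i - b $ i = (a - b) $ i" using i by simp
      then show "a $ i = b $ i" unfolding d using i b by simp
    qed (use a b in simp)
  qed
  have RT: "R * T = 1\<^sub>m m"
  proof (rule eq_matI)
    fix i j assume "i < dim_row (1\<^sub>m m :: 'k mat)" "j < dim_col (1\<^sub>m m :: 'k mat)"
    then have ij: "i < m" "j < m" by auto
    have Tj: "col T j \<in> carrier_vec k" and u: "unit_vec m j \<in> carrier_vec m" using T by auto
    have Tu: "T *\<^sub>v unit_vec m j = col T j" by (rule eq_vecI) (use T ij in auto)
    have "T *\<^sub>v (R *\<^sub>v col T j) = T * R *\<^sub>v col T j" using assoc_mult_mat_vec[OF T R Tj] by simp
    also have "\<dots> = T *\<^sub>v unit_vec m j" unfolding TR Tu using Tj by simp
    finally have "R *\<^sub>v col T j = unit_vec m j"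
      by (rule injD[OF mult_mat_vec_carrier[OF R Tj] u])
    moreover have "(R * T) $$ (i, j) = (R *\<^sub>v col T j) $ i" using ij R T by simp
    ultimately show "(R * T) $$ (i, j) = 1\<^sub>m m $$ (i, j)" using ij by simp
  qed (use T R in auto)
  have "(of_nat k :: 'k) = mat_trace (T * R)" unfolding TR by (simp add: mat_trace_def)
  also have "\<dots> = of_nat m" unfolding trace_mult_commute[OF T R] RT by (simp add: mat_trace_def)
  finally have "k = m" by simp
  then show ?thesis using that R TR RT by blast
qed

lemma sum_div_mod:
  fixes F :: "nat \<Rightarrow> nat \<Rightarrow> 'a::comm_monoid_add"
  shows "(\<Sum>i<m * n. F (i div n) (i mod n)) = (\<Sum>c<m. \<Sum>r<n. F c r)"
proof -
  have "(\<Sum>i<m * n. F (i div n) (i mod n)) = (\<Sum>c<m. \<Sum>i\<in>{c*n..<c*n+n}. F (i div n) (i mod n))"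
    by (rule sum.nat_group[symmetric])
  also have "\<dots> = (\<Sum>c<m. \<Sum>r<n. F c r)"
  proof (rule sum.cong[OF refl])
    fix c
    have "i div n = c \<and> i mod n = i - c * n" if i: "i \<in> {c*n..<c*n+n}" for i
    proof -
      obtain r where "i = c * n + r" "r < n" using i by (auto simp: le_iff_add)
      then show ?thesis by simp
    qed
    then show "(\<Sum>i\<in>{c*n..<c*n+n}. F (i div n) (i mod n)) = (\<Sum>r<n. F c r)"
      by (intro sum.reindex_bij_witness[of _ "\<lambda>r. c * n + r" "\<lambda>i. i - c * n"]) auto
  qed
  finally show ?thesis .
qed

section \<open>Moebius inversion in a finite poset\<close>

text \<open>The recursion defining the Moebius function, solved for zero.\<close>

lemma moebius_upper_sum:
  assumes po: "finite_poset A leq" and x: "x \<in> A" and y: "y \<in> A" and xy: "leq x y"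
  shows "(\<Sum>z\<in>{z\<in>A. leq x z \<and> leq z y}. moebius A leq x z) = (if x = y then 1 else 0)"
proof -
  have fin: "finite {z\<in>A. leq x z \<and> leq z y}" using po by (simp add: finite_poset_def)
  have "{z\<in>A. leq x z \<and> leq z y} = insert y {z\<in>A. leq x z \<and> leq z y \<and> z \<noteq> y}"
    using po y xy by (auto simp: finite_poset_def)
  then have "(\<Sum>z\<in>{z\<in>A. leq x z \<and> leq z y}. moebius A leq x z) =
      moebius A leq x y + (\<Sum>z\<in>{z\<in>A. leq x z \<and> leq z y \<and> z \<noteq> y}. moebius A leq x z)"
    using fin by (simp add: insert_absorb)
  moreover have "{z\<in>A. leq y z \<and> leq z y \<and> z \<noteq> y} = {}"
    using po y by (auto simp: finite_poset_def)
  moreover have "moebius A leq x y = (if x = y then 1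
      else - (\<Sum>z\<in>{z\<in>A. leq x z \<and> leq z y \<and> z \<noteq> y}. moebius A leq x z))"
    using assms by (subst moebius.simps) simp
  ultimately show ?thesis by (cases "x = y") simp_all
qed

text \<open>The recursion makes the Moebius function \<open>\<mu>\<close> a left inverse of the zeta function in the incidence
  algebra; inversion over the lower argument needs it as a right inverse. Bracketing the product
  of \<open>\<mu>\<close>, zeta and \<open>\<mu>\<close> in both ways shows that \<open>\<mu>\<close> times (zeta times \<open>\<mu>\<close>) is \<open>\<mu>\<close>, and zeta times \<open>\<mu>\<close> can be read off by
  induction on the size of the interval.\<close>

lemma moebius_lower_sum:
  assumes po: "finite_poset A leq" and x: "x \<in> A" and y: "y \<in> A"
  shows "(\<Sum>z\<in>{z\<in>A. leq x z \<and> leq z y}. moebius A leq z y) = (if x = y then 1 else 0)"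
  using x
proof (induction "card {z\<in>A. leq x z \<and> leq z y}" arbitrary: x rule: less_induct)
  case less
  define g where "g w = (\<Sum>z\<in>{z\<in>A. leq w z \<and> leq z y}. moebius A leq z y)" for w
  have fin: "finite A" and rfl: "\<And>a. a \<in> A \<Longrightarrow> leq a a"
    and anti: "\<And>a b. a \<in> A \<Longrightarrow> b \<in> A \<Longrightarrow> leq a b \<Longrightarrow> leq b a \<Longrightarrow> a = b"
    and trans: "\<And>a b c. a \<in> A \<Longrightarrow> b \<in> A \<Longrightarrow> c \<in> A \<Longrightarrow> leq a b \<Longrightarrow> leq b c \<Longrightarrow> leq a c"
    using po unfolding finite_poset_def by blast+
  show ?case
  proof (cases "leq x y")
    case False
    then have "{z\<in>A. leq x z \<and> leq z y} = {}" "x \<noteq> y" using trans less.prems y rfl by blast+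
    then show ?thesis by (metis (no_types, lifting) sum.empty)
  next
    case True
    let ?I = "{w\<in>A. leq x w \<and> leq w y}"
    \<comment> \<open>\<open>g\<close> is the product of zeta and \<open>\<mu>\<close>; multiplying it by \<open>\<mu>\<close> from the left gives back \<open>\<mu>\<close>.\<close>
    have "(\<Sum>w\<in>?I. moebius A leq x w * g w) =
        (\<Sum>w\<in>?I. \<Sum>z\<in>{z\<in>?I. leq w z}. moebius A leq x w * moebius A leq z y)"
      unfolding g_def sum_distrib_left
    proof (rule sum.cong[OF refl], rule sum.cong)
      fix w assume "w \<in> ?I"
      then show "{z\<in>A. leq w z \<and> leq z y} = {z\<in>?I. leq w z}" using trans less.prems by blast
    qed simp
    also have "\<dots> = (\<Sum>z\<in>?I. \<Sum>w\<in>{w\<in>?I. leq w z}. moebius A leq x w * moebius A leq z y)"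
      using fin by (intro sum.swap_restrict) auto
    also have "\<dots> = (\<Sum>z\<in>?I. (\<Sum>w\<in>{w\<in>A. leq x w \<and> leq w z}. moebius A leq x w) * moebius A leq z y)"
      unfolding sum_distrib_right
    proof (rule sum.cong[OF refl], rule sum.cong)
      fix z assume "z \<in> ?I"
      then show "{w\<in>?I. leq w z} = {w\<in>A. leq x w \<and> leq w z}" using trans y by blast
    qed simp
    also have "\<dots> = (\<Sum>z\<in>?I. (if x = z then 1 else 0) * moebius A leq z y)"
      using moebius_upper_sum[OF po less.prems] by (intro sum.cong refl) auto
    also have "\<dots> = (\<Sum>z\<in>?I. if z = x then moebius A leq z y else 0)"
      by (intro sum.cong) auto
    also have "\<dots> = moebius A leq x y"
      using fin True less.prems rfl by (simp add: sum.delta)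
    finally have 1: "(\<Sum>w\<in>?I. moebius A leq x w * g w) = moebius A leq x y" .
    have I: "?I = insert x (?I - {x})" "finite ?I" using True less.prems rfl fin by auto
    have "g w = (if w = y then 1 else 0)" if w: "w \<in> ?I - {x}" for w
      unfolding g_def
    proof (rule less.hyps)
      have "{z \<in> A. leq w z \<and> leq z y} \<subseteq> ?I" using trans w less.prems by blast
      moreover have "x \<notin> {z \<in> A. leq w z \<and> leq z y}" using anti[of x w] w less.prems by auto
      moreover have "x \<in> ?I" using True less.prems rfl by auto
      ultimately show "card {z \<in> A. leq w z \<and> leq z y} < card ?I"
        using I(2) by (intro psubset_card_mono) auto
    qed (use w in auto)
    then have "(\<Sum>w\<in>?I - {x}. moebius A leq x w * g w) =
        (\<Sum>w\<in>?I - {x}. if w = y then moebius A leq x w else 0)"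
      by (intro sum.cong refl) auto
    also have "\<dots> = (if x = y then 0 else moebius A leq x y)"
      using I(2) True y rfl by (simp add: sum.delta)
    finally have "moebius A leq x x * g x + (if x = y then 0 else moebius A leq x y) = moebius A leq x y"
      using 1 sum.remove[OF I(2), of x "\<lambda>w. moebius A leq x w * g w"] True less.prems rfl by simp
    moreover have "moebius A leq x x = 1"
      using po less.prems rfl by (subst moebius.simps) auto
    ultimately show ?thesis unfolding g_def by (auto split: if_splits)
  qed
qed

section \<open>Semigroups with commuting idempotents\<close>

text \<open>In a minimal subsemigroup \<open>C\<close> every element \<open>a\<close> is idempotent: \<open>aC\<close> is a subsemigroup, hence equal to \<open>C\<close>;
  so \<open>{x \<in> C. ax = a}\<close> is a nonempty subsemigroup, hence also equal to \<open>C\<close>.\<close>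

lemma finite_subsemigroup_has_idempotent:
  fixes C :: "'s::{semigroup_mult,finite} set"
  assumes "C \<noteq> {}" "\<And>x y. x \<in> C \<Longrightarrow> y \<in> C \<Longrightarrow> x * y \<in> C"
  shows "\<exists>i\<in>C. i * i = i"
  using assms
proof (induction "card C" arbitrary: C rule: less_induct)
  case less
  then obtain a where a: "a \<in> C" by blast
  let ?aC = "(*) a ` C" and ?F = "{x\<in>C. a * x = a}"
  show ?case
  proof (cases "?aC = C \<and> ?F = C")
    case True
    then show ?thesis using a by auto
  next
    case False
    have fin: "finite C" by simp
    consider "?aC \<subset> C" | "?aC = C" "?F \<subset> C"
      using False less.prems(2) a by blast
    then show ?thesis
    proof cases
      case 1
      have "\<exists>i\<in>?aC. i * i = i"
      proof (rule less.hyps)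
        show "card ?aC < card C" using 1 by (simp add: psubset_card_mono)
        show "?aC \<noteq> {}" using a by blast
        fix x y assume "x \<in> ?aC" "y \<in> ?aC"
        then obtain c d where "x = a * c" "y = a * d" "c \<in> C" "d \<in> C" by blast
        then show "x * y \<in> ?aC" using less.prems(2) a
          by (metis image_eqI mult.assoc)
      qed
      then show ?thesis using 1 by blast
    next
      case 2
      have "\<exists>i\<in>?F. i * i = i"
      proof (rule less.hyps)
        show "card ?F < card C" using 2 by (simp add: psubset_card_mono)
        show "?F \<noteq> {}" using 2(1) a by (metis (mono_tags, lifting) empty_iff imageE mem_Collect_eq)
        show "x * y \<in> ?F" if "x \<in> ?F" "y \<in> ?F" for x y
          using that less.prems(2) by (auto simp flip: mult.assoc)
      qed
      then show ?thesis by blast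
    qed
  qed
qed

locale commuting_idempotents_at =
  fixes e :: "'s::{semigroup_mult,finite}"
  assumes comm: "\<And>x y :: 's. x \<in> idems \<Longrightarrow> y \<in> idems \<Longrightarrow> x * y = y * x"
    and e_idem: "e \<in> idems"
begin

abbreviation G where "G \<equiv> max_subgroup e"

lemma ee [simp]: "e * e = e" "e * (e * x) = e * x"
  using e_idem by (simp_all add: idems_def flip: mult.assoc)

text \<open>Both \<open>t\<close> and \<open>u\<close> are equal to \<open>t * s * u\<close>, because the idempotents \<open>s * t\<close>, \<open>s * u\<close> commute, and so do
  \<open>t * s\<close>, \<open>u * s\<close>.\<close>

lemma inverse_unique:
  fixes s :: 's
  assumes "s * t * s = s" "t * s * t = t" "s * u * s = s" "u * s * u = u"
  shows "t = u"
proof -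
  have id: "s * t \<in> idems" "t * s \<in> idems" "s * u \<in> idems" "u * s \<in> idems"
    using assms by (simp_all add: idems_def flip: mult.assoc)
  have "t = t * (s * u * s) * t" using assms by simp
  also have "\<dots> = t * (s * u) * (s * t)" by (simp add: mult.assoc)
  also have "\<dots> = t * (s * t) * (s * u)" using comm[OF id(3,1)] by (simp add: mult.assoc)
  also have "\<dots> = t * s * u" using assms by (simp flip: mult.assoc)
  finally have 1: "t = t * s * u" .
  have "u = u * (s * t * s) * u" using assms by simp
  also have "\<dots> = (u * s) * (t * s) * u" by (simp add: mult.assoc)
  also have "\<dots> = (t * s) * (u * s) * u" using comm[OF id(4,2)] by simp
  also have "\<dots> = t * s * u" using assms by (simp add: mult.assoc)
  finally show ?thesis using 1 by simp
qed

lemma sinv_eqI: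
  fixes s :: 's
  assumes "s * t * s = s" "t * s * t = t"
  shows "s \<in> regulars" "sinv s = t"
proof -
  show "s \<in> regulars" using assms unfolding regulars_def by blast
  show "sinv s = t" unfolding sinv_def using assms inverse_unique by blast
qed

lemma sinv:
  assumes "(s::'s) \<in> regulars"
  shows "s * sinv s * s = s" "sinv s * s * sinv s = sinv s"
    "s * (sinv s * s) = s" "sinv s * (s * sinv s) = sinv s"
    "s * (sinv s * (s * x)) = s * x" "sinv s * (s * (sinv s * x)) = sinv s * x"
proof -
  obtain t where "s * t * s = s" "t * s * t = t" using assms unfolding regulars_def by blast
  then show 1: "s * sinv s * s = s" "sinv s * s * sinv s = sinv s" using sinv_eqI(2) by metis+
  then show "s * (sinv s * s) = s" "sinv s * (s * sinv s) = sinv s"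
    "s * (sinv s * (s * x)) = s * x" "sinv s * (s * (sinv s * x)) = sinv s * x"
    by (simp_all flip: mult.assoc)
qed

lemma sinv_regular:
  assumes "(s::'s) \<in> regulars" shows "sinv s \<in> regulars" "sinv (sinv s) = s"
  using sinv_eqI[OF sinv(2,1)[OF assms]] by auto

lemma idem_sinv:
  assumes "(f::'s) \<in> idems" shows "f \<in> regulars" "sinv f = f"
  using assms sinv_eqI[of f f] by (auto simp: idems_def)

lemma sinv_idems:
  assumes "(s::'s) \<in> regulars" shows "s * sinv s \<in> idems" "sinv s * s \<in> idems"
  using sinv[OF assms] by (auto simp: idems_def mult.assoc)

lemma idems_mult:
  assumes "(f::'s) \<in> idems" "h \<in> idems" shows "f * h \<in> idems"
proof -
  have "f * h * (f * h) = f * (h * f) * h" by (simp add: mult.assoc)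
  also have "\<dots> = (f * f) * (h * h)" unfolding comm[OF assms(2,1)] by (simp add: mult.assoc)
  finally show ?thesis using assms by (simp add: idems_def)
qed

lemma regulars_mult:
  assumes s: "(s::'s) \<in> regulars" and t: "t \<in> regulars"
  shows "s * t \<in> regulars" "sinv (s * t) = sinv t * sinv s"
proof -
  have c: "sinv s * s * (t * sinv t) = t * sinv t * (sinv s * s)"
    using comm sinv_idems s t by blast
  have "s * t * (sinv t * sinv s) * (s * t) = s * (t * sinv t * (sinv s * s)) * t"
    by (simp add: mult.assoc)
  also have "\<dots> = s * t" unfolding c[symmetric] using sinv[OF s] sinv[OF t] by (simp add: mult.assoc)
  finally have 1: "s * t * (sinv t * sinv s) * (s * t) = s * t" .
  have "sinv t * sinv s * (s * t) * (sinv t * sinv s) = sinv t * (sinv s * s * (t * sinv t)) * sinv s"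
    by (simp add: mult.assoc)
  also have "\<dots> = sinv t * sinv s" unfolding c using sinv[OF s] sinv[OF t] by (simp add: mult.assoc)
  finally show "s * t \<in> regulars" "sinv (s * t) = sinv t * sinv s" using sinv_eqI[OF 1] by auto
qed

lemma G_D:
  assumes "g \<in> G"
  shows "g \<in> regulars" "g * sinv g = e" "sinv g * g = e" "e * g = g" "g * e = g"
    "e * sinv g = sinv g" "sinv g * e = sinv g"
    "g * (sinv g * x) = e * x" "sinv g * (g * x) = e * x"
    "e * (g * x) = g * x" "g * (e * x) = g * x" "e * (sinv g * x) = sinv g * x" "sinv g * (e * x) = sinv g * x"
proof -
  show 1: "g \<in> regulars" "g * sinv g = e" "sinv g * g = e" using assms by (auto simp: max_subgroup_def)
  note r = sinv[OF 1(1)]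
  show 2: "e * g = g" "g * e = g" "e * sinv g = sinv g" "sinv g * e = sinv g"
    using r(1,3) r(2,4) unfolding 1(2,3) by (simp_all add: mult.assoc)
  show "g * (sinv g * x) = e * x" "sinv g * (g * x) = e * x"
    "e * (g * x) = g * x" "g * (e * x) = g * x" "e * (sinv g * x) = sinv g * x" "sinv g * (e * x) = sinv g * x"
    by (simp_all only: 1 2 mult.assoc[symmetric])
qed

lemma G_I:
  assumes "g * h = e" "h * g = e" "e * g = g" "e * h = h"
  shows "g \<in> G" "sinv g = h"
proof -
  have "g * h * g = g" "h * g * h = h" using assms by simp_all
  from sinv_eqI[OF this] show "g \<in> G" "sinv g = h" using assms by (auto simp: max_subgroup_def)
qed

lemma G_e: "e \<in> G" "sinv e = e"
  using G_I[of e e] by simp_all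

lemma G_sinv: assumes "g \<in> G" shows "sinv g \<in> G" "sinv (sinv g) = g"
  using G_I[of "sinv g" g] G_D[OF assms] by auto

lemma G_mult: assumes "g \<in> G" "h \<in> G" shows "g * h \<in> G" "sinv (g * h) = sinv h * sinv g"
proof -
  have "g * h * (sinv h * sinv g) = e" "sinv h * sinv g * (g * h) = e" "e * (g * h) = g * h"
    "e * (sinv h * sinv g) = sinv h * sinv g"
    using G_D[OF assms(1)] G_D[OF assms(2)] by (simp_all add: mult.assoc)
  from G_I[OF this] show "g * h \<in> G" "sinv (g * h) = sinv h * sinv g" by auto
qed

lemma bij_mult_G: assumes "g \<in> G" shows "bij_betw ((*) g) G G"
  by (rule bij_betwI[where g="(*) (sinv g)"])
    (auto simp: G_D(8,9)[OF assms] G_D(4) intro!: G_mult(1) G_sinv(1) assms)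

text \<open>In the finite monoid \<open>eSe\<close> an element with a right inverse is a unit: left multiplication by it is
  onto, hence one-to-one.\<close>

lemma right_invertible_in_G:
  assumes b: "e * b = b" "b * e = b" and w: "b * w = e"
  shows "b \<in> G"
proof -
  let ?M = "{x. e * x = x \<and> x * e = x}"
  define v where "v = e * w * e"
  have bv: "b * v = e" unfolding v_def using b w by (simp flip: mult.assoc)
  have v: "v \<in> ?M" by (simp add: v_def mult.assoc)
  have M_mult: "x * y \<in> ?M" if "x \<in> ?M" "y \<in> ?M" for x y
    using that by (simp add: mult.assoc) (simp flip: mult.assoc)
  have "x \<in> (*) b ` ?M" if "x \<in> ?M" for x
  proof (rule image_eqI)
    show "x = b * (v * x)" using that bv by (simp flip: mult.assoc)
    show "v * x \<in> ?M" using M_mult v that .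
  qed
  then have "?M \<subseteq> (*) b ` ?M" by (rule subsetI)
  moreover have "(*) b ` ?M \<subseteq> ?M" by (rule image_subsetI, rule M_mult) (use b in auto)
  ultimately have "(*) b ` ?M = ?M" by (rule subset_antisym[rotated])
  then have inj: "inj_on ((*) b) ?M" by (simp add: eq_card_imp_inj_on)
  have "b * (v * b) = b * e" using bv b by (simp flip: mult.assoc)
  moreover have "v * b \<in> ?M" "e \<in> ?M" using M_mult v b by auto
  ultimately have "v * b = e" by (rule inj_onD[OF inj])
  then show ?thesis using G_I[OF bv] b v by auto
qed

end

text \<open>The coefficients of the element \<open>\<eta> = (\<Sum>f \<le> e. \<mu>(f,e) f)\<close> of the semigroup algebra.\<close>

definition idem_coeff :: "'s::semigroup_mult \<Rightarrow> 's \<Rightarrow> 'k::field" where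
  "idem_coeff e u = (if u \<in> idems \<and> idem_le u e then of_int (moebius idems idem_le u e) else 0)"

context commuting_idempotents_at
begin

lemma idem_le_iff:
  fixes f h :: 's
  assumes "f \<in> idems" "h \<in> idems"
  shows "idem_le f h \<longleftrightarrow> f * h = f"
  using comm[OF assms] by (auto simp: idem_le_def)

lemma idem_le_mult_iff:
  fixes x u h :: 's
  assumes "x \<in> idems" "u \<in> idems" "h \<in> idems"
  shows "idem_le x (u * h) \<longleftrightarrow> idem_le x u \<and> idem_le x h"
proof -
  have "x * (u * h) = x \<longleftrightarrow> x * u = x \<and> x * h = x"
  proof
    assume a: "x * (u * h) = x"
    have "x * h = x * (u * (h * h))" using a by (simp flip: mult.assoc)
    moreover have "x * u = x * (h * (u * u))" using a comm[OF assms(2,3)] by (simp flip: mult.assoc)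
    moreover have "h * h = h" "u * u = u" using assms by (auto simp: idems_def)
    ultimately show "x * u = x \<and> x * h = x" using a comm[OF assms(2,3)] by simp
  qed (simp flip: mult.assoc)
  then show ?thesis using assms idems_mult by (simp add: idem_le_iff)
qed

lemma idem_coeff_e: "idem_coeff e e = 1"
proof -
  have "idem_le e e" by (simp add: idem_le_def)
  then show ?thesis using e_idem partial_order_idems[where 's='s]
    unfolding idem_coeff_def by (subst moebius.simps) simp
qed

lemma idem_coeff_upper_sum:
  assumes "x \<in> idems"
  shows "(\<Sum>u\<in>{u. idem_le x u}. idem_coeff e u :: 'k::field_char_0) = (if x = e then 1 else 0)"
proof -
  have "(\<Sum>u\<in>{u. idem_le x u}. idem_coeff e u :: 'k) =
      (\<Sum>u\<in>{u\<in>idems. idem_le x u \<and> idem_le u e}. of_int (moebius idems idem_le u e))"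
    by (rule sum.mono_neutral_cong_right) (auto simp: idem_coeff_def)
  also have "\<dots> = of_int (\<Sum>u\<in>{u\<in>idems. idem_le x u \<and> idem_le u e}. moebius idems idem_le u e)"
    by simp
  also have "\<dots> = (if x = e then 1 else 0)"
    unfolding moebius_lower_sum[OF partial_order_idems assms e_idem] by simp
  finally show ?thesis .
qed

text \<open>The sum is the coefficient of \<open>k\<close> in \<open>\<eta>h\<close>, so this says that \<open>\<eta>h = 0\<close> (a case of Weisner's theorem).
  All \<open>y\<close> in the support satisfy \<open>y \<le> eh < e\<close>. For \<open>x \<le> h\<close> one has \<open>x \<le> uh\<close> if and only if \<open>x \<le> u\<close>, so the
  coefficients of \<open>\<eta>h\<close> at the elements above \<open>x\<close> have the same sum as those of \<open>\<eta>\<close>, which is \<open>0\<close> unless \<open>x = e\<close>.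
  But if \<open>x\<close> is maximal in the support, that sum is the nonzero coefficient at \<open>x\<close>.\<close>

lemma idem_coeff_annihilates:
  assumes h: "h \<in> idems" and he: "e * h \<noteq> e"
  shows "(\<Sum>u\<in>{u. u * h = k}. idem_coeff e u :: 'k::field_char_0) = 0"
proof (rule ccontr)
  define r where "r k = (\<Sum>u\<in>{u. u * h = k}. idem_coeff e u :: 'k)" for k
  assume "(\<Sum>u\<in>{u. u * h = k}. idem_coeff e u :: 'k) \<noteq> 0"
  then have "r k \<noteq> 0" by (simp add: r_def)
  \<comment> \<open>An element of the support with the fewest idempotents above it is maximal in the support.\<close>
  from ex_has_least_nat[of "\<lambda>k. r k \<noteq> 0" k "\<lambda>k. card {z. idem_le k z}", OF this]
  obtain x where x: "r x \<noteq> 0"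
    and maxl: "\<And>y. r y \<noteq> 0 \<Longrightarrow> card {z. idem_le x z} \<le> card {z. idem_le y z}" by blast
  have supp: "y \<in> idems \<and> idem_le y (e * h)" if y: "r y \<noteq> 0" for y
  proof -
    from y obtain u where "u \<in> {u. u * h = y}" "idem_coeff e u \<noteq> (0::'k)"
      unfolding r_def by (rule sum.not_neutral_contains_not_neutral)
    then have u: "u \<in> idems" "u * e = u" "y = u * h" by (auto simp: idem_coeff_def idem_le_def split: if_splits)
    have "y * (e * h) = u * (h * e) * h" using u by (simp add: mult.assoc)
    also have "\<dots> = u * e * (h * h)" using comm[OF h e_idem] by (simp add: mult.assoc)
    also have "\<dots> = y" using u h by (simp add: idems_def)
    finally show ?thesis using u h e_idem by (simp add: idem_le_iff idems_mult)
  qed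
  have x1: "x \<in> idems" "idem_le x (e * h)" using supp x by auto
  then have xh: "idem_le x e" "idem_le x h" using idem_le_mult_iff e_idem h by blast+
  have xe: "x \<noteq> e" using xh he by (auto simp: idem_le_def comm[OF h e_idem])
  have trans: "idem_le a c" if "idem_le a b" "idem_le b c" for a b c :: 's
    using that unfolding idem_le_def by (metis mult.assoc)
  have "r y = 0" if "y \<in> {y\<in>idems. idem_le x y} - {x}" for y
  proof (rule ccontr)
    assume "r y \<noteq> 0"
    have "{z. idem_le y z} \<subset> {z. idem_le x z}"
    proof
      show "{z. idem_le y z} \<subseteq> {z. idem_le x z}" using that trans by blast
      have "idem_le x x" using x1 by (simp add: idem_le_def idems_def)
      moreover have "\<not> idem_le y x" using that by (auto simp: idem_le_def)
      ultimately show "{z. idem_le y z} \<noteq> {z. idem_le x z}" by blast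
    qed
    then have "card {z. idem_le y z} < card {z. idem_le x z}" by (simp add: psubset_card_mono)
    then show False using maxl[OF \<open>r y \<noteq> 0\<close>] by simp
  qed
  then have "(\<Sum>y\<in>{y\<in>idems. idem_le x y}. r y) = (\<Sum>y\<in>{x}. r y)"
    by (intro sum.mono_neutral_right) (use x1 in \<open>auto simp: idem_le_def idems_def\<close>)
  moreover have "(\<Sum>y\<in>{y\<in>idems. idem_le x y}. r y) =
      (\<Sum>y\<in>{y\<in>idems. idem_le x y}. \<Sum>u\<in>{u\<in>{u. u * h \<in> idems \<and> idem_le x (u * h)}. u * h = y}. idem_coeff e u)"
    unfolding r_def by (intro sum.cong refl) auto
  moreover have "\<dots> = (\<Sum>u\<in>{u. u * h \<in> idems \<and> idem_le x (u * h)}. idem_coeff e u)"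
    by (rule sum.group) auto
  moreover have "\<dots> = (\<Sum>u\<in>{u. idem_le x u}. idem_coeff e u)"
    using x1(1) xh(2) h idem_le_mult_iff
    by (intro sum.mono_neutral_cong) (auto simp: idem_coeff_def idems_mult)
  ultimately have "r x = (if x = e then 1 else 0)"
    using idem_coeff_upper_sum[OF x1(1), where 'k='k] by simp
  then show False using x xe by simp
qed

section \<open>Green's classes of an idempotent\<close>

definition R_class :: "'s set" where "R_class = {a \<in> regulars. a * sinv a = e}"
definition L_class :: "'s set" where "L_class = {y \<in> regulars. sinv y * y = e}"

lemma R_class_D:
  assumes "a \<in> R_class"
  shows "a \<in> regulars" "a * sinv a = e" "e * a = a" "sinv a * e = sinv a"
    "a * (sinv a * x) = e * x" "e * (a * x) = a * x" "sinv a * (e * x) = sinv a * x"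
    "a * (sinv a * a) = a" "sinv a * a \<in> idems"
proof -
  show 1: "a \<in> regulars" "a * sinv a = e" using assms by (auto simp: R_class_def)
  show 2: "e * a = a" "sinv a * e = sinv a" using sinv[OF 1(1)] 1(2) by auto
  show "a * (sinv a * x) = e * x" "e * (a * x) = a * x" "sinv a * (e * x) = sinv a * x"
    by (simp_all only: 1 2 mult.assoc[symmetric])
  show "a * (sinv a * a) = a" "sinv a * a \<in> idems" using sinv[OF 1(1)] sinv_idems[OF 1(1)] by auto
qed

lemma L_class_D:
  assumes "y \<in> L_class"
  shows "y \<in> regulars" "sinv y * y = e" "y * e = y" "e * sinv y = sinv y"
  using assms sinv[of y] by (auto simp: L_class_def)

lemma R_class_sinv: "a \<in> R_class \<Longrightarrow> sinv a \<in> L_class"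
  using sinv_regular by (simp add: R_class_def L_class_def)

lemma L_class_sinv: "y \<in> L_class \<Longrightarrow> sinv y \<in> R_class"
  using sinv_regular by (simp add: R_class_def L_class_def)

text \<open>If \<open>g = c * y\<close> is a unit of \<open>eSe\<close>, then \<open>y\<close> and \<open>sinv g * c\<close> are mutually inverse, because \<open>y * sinv g * c * y = y * e\<close>.\<close>

lemma L_class_if_translate_in_G:
  assumes c: "e * c = c" and y: "y * e = y" and g: "c * y \<in> G"
  shows "y \<in> L_class" "sinv y = sinv (c * y) * c"
proof -
  note G = G_D[OF g]
  have "y * (sinv (c * y) * c) * y = y" "sinv (c * y) * c * y * (sinv (c * y) * c) = sinv (c * y) * c"
    using G(3,6) y by (simp_all add: mult.assoc) (metis G(3,6) mult.assoc)
  note * = sinv_eqI[OF this]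
  show "sinv y = sinv (c * y) * c" by (rule *)
  then show "y \<in> L_class" using * G(3) by (simp add: L_class_def mult.assoc)
qed

text \<open>With the lemma after it this describes \<open>L_class\<close> as the disjoint union of cosets \<open>sinv a * G\<close>, one \<open>a \<in> R_class\<close> for
  each idempotent \<open>sinv a * a\<close>: an element \<open>y\<close> lies in the coset of \<open>a\<close> if \<open>a * y \<in> G\<close>, and the idempotent
  \<open>y * sinv y\<close> tells which coset it is.\<close>

lemma translate_in_G_D:
  assumes a: "a \<in> R_class" and y: "y * e = y" and g: "a * y \<in> G"
  shows "y \<in> L_class" "y * sinv y = sinv a * a" "sinv a * (a * y) = y"
proof -
  note A = R_class_D[OF a] and G = G_D[OF g]
  note L = L_class_if_translate_in_G[OF A(3) y g]
  show 1: "y \<in> L_class" by (rule L)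
  have i: "y * sinv y \<in> idems" using sinv_idems L_class_D[OF 1] by blast
  have "y * sinv y * (sinv a * a) = y * sinv (a * y) * (a * (sinv a * a))"
    unfolding L(2) by (simp add: mult.assoc)
  then have "y * sinv y * (sinv a * a) = y * sinv y" unfolding A(8) L(2) by (simp add: mult.assoc)
  moreover have "sinv a * a * (y * sinv y) = sinv a * (a * y * sinv (a * y)) * a"
    unfolding L(2) by (simp add: mult.assoc)
  then have "sinv a * a * (y * sinv y) = sinv a * a" unfolding G(2) using A(4) by simp
  ultimately show 2: "y * sinv y = sinv a * a" using comm[OF i A(9)] by simp
  show "sinv a * (a * y) = y" using 2 sinv[OF L_class_D(1)[OF 1]] by (simp flip: mult.assoc)
qed

text \<open>The inverse of \<open>a * y\<close> is \<open>sinv y * sinv a\<close>; the factors cancel because the two idempotents in the middle agree.\<close>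

lemma translate_in_G_I:
  assumes y: "y \<in> L_class" and a: "a \<in> R_class" and f: "sinv a * a = y * sinv y"
  shows "a * y \<in> G"
proof (rule G_I)
  note A = R_class_D[OF a] and Y = L_class_D[OF y]
  have "a * y * (sinv y * sinv a) = a * (sinv a * a) * sinv a" unfolding f by (simp add: mult.assoc)
  then show "a * y * (sinv y * sinv a) = e" using A by (simp add: mult.assoc)
  have "sinv y * sinv a * (a * y) = sinv y * (sinv a * a) * y" by (simp add: mult.assoc)
  then show "sinv y * sinv a * (a * y) = e" unfolding f using Y sinv[OF Y(1)] by (simp add: mult.assoc)
  show "e * (a * y) = a * y" using A by simp
  show "e * (sinv y * sinv a) = sinv y * sinv a" using Y by (simp flip: mult.assoc)
qed

lemma index_idems_eq: "index_idems e = {y * sinv y | y. y \<in> L_class}"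
proof (intro equalityI subsetI)
  fix f assume "f \<in> index_idems e"
  then obtain q where "q \<in> R_class" "f = sinv q * q" by (auto simp: index_idems_def R_class_def)
  then show "f \<in> {y * sinv y | y. y \<in> L_class}"
    using R_class_sinv[of q] sinv_regular(2)[of q] R_class_D(1)[of q] by (auto intro!: exI[of _ "sinv q"])
next
  fix f assume "f \<in> {y * sinv y | y. y \<in> L_class}"
  then obtain y where y: "y \<in> L_class" "f = y * sinv y" by blast
  then show "f \<in> index_idems e"
    using L_class_sinv[OF y(1)] L_class_D[OF y(1)] sinv_regular[of y] sinv_idems[of y]
    by (auto simp: index_idems_def R_class_def intro!: bexI[of _ "sinv y"])
qed

section \<open>A closed formula for the associated representation\<close>

text \<open>The two conditions on \<open>u\<close> in the definition of \<open>\<phi>\<^sup>*\<close> amount to a membership in \<open>G\<close> that makes sense for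
  arbitrary semigroup elements; this is what the formula for nonregular elements rests on.\<close>

lemma phi_star_condition:
  assumes u: "u \<in> regulars" and a: "a \<in> R_class" and b: "b \<in> R_class"
  shows "idem_le (sinv a * a) (u * sinv u) \<and> sinv u * (sinv a * a) * u = sinv b * b \<longleftrightarrow> a * u * sinv b \<in> G"
    (is "?l \<longleftrightarrow> _")
proof
  note A = R_class_D[OF a] and B = R_class_D[OF b] and U = sinv[OF u]
  have br: "sinv b * e = sinv b" "sinv b \<in> regulars" "sinv (sinv b) = b" using B sinv_regular[OF B(1)] by auto
  { assume ?l
    then have l: "sinv a * a * (u * sinv u) = sinv a * a" "sinv u * (sinv a * a) * u = sinv b * b"
      using idem_le_iff A(9) sinv_idems[OF u] by auto
    show "a * u * sinv b \<in> G"
    proof (rule G_I)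
      have "a * u * sinv b * (b * sinv u * sinv a) = a * u * (sinv u * (sinv a * a) * u) * sinv u * sinv a"
        unfolding l(2) by (simp add: mult.assoc)
      also have "\<dots> = a * (u * sinv u * (sinv a * a)) * (u * sinv u) * sinv a" by (simp add: mult.assoc)
      also have "\<dots> = a * (sinv a * a) * (u * sinv u) * sinv a"
        using comm[OF A(9) sinv_idems(1)[OF u]] l(1) by simp
      also have "\<dots> = a * (sinv a * a * (u * sinv u)) * sinv a" by (simp add: mult.assoc)
      also have "\<dots> = e" unfolding l(1) using A by simp
      finally show "a * u * sinv b * (b * sinv u * sinv a) = e" .
      have "b * sinv u * sinv a * (a * u * sinv b) = b * (sinv u * (sinv a * a) * u) * sinv b"
        by (simp add: mult.assoc)
      also have "\<dots> = e" unfolding l(2) using B by simp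
      finally show "b * sinv u * sinv a * (a * u * sinv b) = e" .
      show "e * (a * u * sinv b) = a * u * sinv b" "e * (b * sinv u * sinv a) = b * sinv u * sinv a"
        using A B by (simp_all add: mult.assoc)
    qed }
  { assume "a * u * sinv b \<in> G"
    then have g: "a * (u * sinv b) \<in> G" by (simp add: mult.assoc)
    have "u * sinv b * e = u * sinv b" using B by (simp add: mult.assoc)
    from translate_in_G_D[OF a this g] have t: "u * sinv b \<in> L_class"
      and "u * sinv b * sinv (u * sinv b) = sinv a * a" by auto
    then have f: "sinv a * a = u * (sinv b * b) * sinv u"
      using regulars_mult(2)[OF u br(2)] br(3) by (simp add: mult.assoc)
    have fu: "sinv a * a * (u * sinv u) = sinv a * a" unfolding f using U by (simp add: mult.assoc)
    have "sinv u * (sinv a * a) * u = sinv u * u * (sinv b * b) * (sinv u * u)"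
      unfolding f by (simp add: mult.assoc)
    then have *: "sinv u * (sinv a * a) * u = sinv u * u * (sinv b * b)"
      using comm[OF B(9) sinv_idems(2)[OF u]] U by (simp add: mult.assoc)
    have "sinv (u * sinv b) * (u * sinv b) = e" using t by (simp add: L_class_def)
    then have "b * (sinv u * u) * sinv b = e"
      using regulars_mult(2)[OF u br(2)] br(3) by (simp add: mult.assoc)
    then have "sinv b * (b * (sinv u * u) * sinv b) * b = sinv b * b" using B by simp
    then have "sinv b * b * (sinv u * u) * (sinv b * b) = sinv b * b" by (simp add: mult.assoc)
    moreover have "sinv b * b * (sinv u * u) * (sinv b * b) = sinv u * u * (sinv b * (b * (sinv b * b)))"
      unfolding comm[OF B(9) sinv_idems(2)[OF u]] by (simp add: mult.assoc)
    ultimately have "sinv u * u * (sinv b * b) = sinv b * b" unfolding B(8) by simp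
    then show ?l using * fu idem_le_iff A(9) sinv_idems[OF u] by auto }
qed

text \<open>For \<open>i = a * h * sinv a\<close> and \<open>z = a * y * sinv b\<close> the product \<open>i * z\<close> is a unit of \<open>eSe\<close>. Since \<open>i\<close> is
  idempotent this forces \<open>i = e\<close>, so that passing from \<open>y\<close> to the smaller \<open>h * y\<close> changes nothing.\<close>

lemma translate_le:
  assumes a: "a \<in> R_class" and b: "b \<in> R_class" and h: "h \<in> idems" and g: "a * (h * y) * sinv b \<in> G"
  shows "a * y * sinv b = a * (h * y) * sinv b" "sinv a * a * h = sinv a * a"
proof -
  note A = R_class_D[OF a] and B = R_class_D[OF b] and G = G_D[OF g]
  let ?g = "a * (h * y) * sinv b" and ?z = "a * y * sinv b" and ?i = "a * h * sinv a"
  have ii: "?i * ?i = ?i"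
  proof -
    have "?i * ?i = a * (h * (sinv a * a)) * h * sinv a" by (simp add: mult.assoc)
    also have "\<dots> = a * (sinv a * a) * (h * h) * sinv a" unfolding comm[OF h A(9)] by (simp add: mult.assoc)
    finally show ?thesis using h A by (simp add: idems_def)
  qed
  have iz: "?i * ?z = ?g"
  proof -
    have "?i * ?z = a * (h * (sinv a * a)) * y * sinv b" by (simp add: mult.assoc)
    also have "\<dots> = a * (sinv a * a) * (h * y) * sinv b" unfolding comm[OF h A(9)] by (simp add: mult.assoc)
    finally show ?thesis using A by simp
  qed
  have "?i * ?g = ?i * ?i * ?z" by (simp only: iz mult.assoc[of ?i ?i ?z])
  then have ig: "?i * ?g = ?g" by (simp only: ii iz)
  have "?i * e = ?i * ?g * sinv ?g" by (simp only: mult.assoc[of ?i ?g "sinv ?g"] G(2))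
  also have "\<dots> = e" by (simp only: ig G(2))
  finally have ie: "?i = e" using A by (simp add: mult.assoc)
  show "?z = ?g" using iz unfolding ie using A by (simp add: mult.assoc)
  have "sinv a * a * h = sinv a * (a * (sinv a * a)) * h" using A by simp
  also have "\<dots> = sinv a * a * (h * (sinv a * a))" unfolding comm[OF h A(9)] by (simp add: mult.assoc)
  also have "\<dots> = sinv a * ?i * a" by (simp add: mult.assoc)
  also have "\<dots> = sinv a * a" unfolding ie using A by simp
  finally show "sinv a * a * h = sinv a * a" .
qed

text \<open>Idempotents give block diagonal matrices: an idempotent can only carry a coset to itself.\<close>

lemma idem_translate_in_G_iff:
  assumes a: "a \<in> R_class" and b: "b \<in> R_class" and h: "h \<in> idems"
  shows "a * h * sinv b \<in> G \<longleftrightarrow> sinv a * a = sinv b * b \<and> idem_le (sinv a * a) h \<and> a * sinv b \<in> G"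
    (is "_ \<longleftrightarrow> ?r")
proof
  note A = R_class_D[OF a] and B = R_class_D[OF b] and H = idem_sinv[OF h]
  have hh: "h * h = h" "h * (h * x) = h * x" for x using h by (simp_all add: idems_def flip: mult.assoc)
  note c = phi_star_condition[OF H(1) a b, unfolded H(2) hh(1)]
  show ?r if g: "a * h * sinv b \<in> G"
  proof -
    have le: "idem_le (sinv a * a) h" and eq: "h * (sinv a * a) * h = sinv b * b" using c g by auto
    have "h * (sinv a * a) * h = sinv a * a" using le by (simp add: idem_le_def)
    moreover have "a * h = a"
      using le A(8) unfolding idem_le_def by (metis mult.assoc)
    ultimately show ?r using eq le g by simp
  qed
  show "a * h * sinv b \<in> G" if ?r
  proof -
    have "a * h = a" using that A(8) unfolding idem_le_def by (metis mult.assoc)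
    then show ?thesis using that by simp
  qed
qed

text \<open>An entry of the associated representation at \<open>s\<close> will be \<open>block_entry v a b s\<close>, where \<open>v\<close> is a matrix
  coefficient of \<open>\<phi>\<close> and \<open>a\<close>, \<open>b\<close> are the chosen elements for the row and the column block.\<close>

definition block_entry :: "('s \<Rightarrow> 'k) \<Rightarrow> 's \<Rightarrow> 's \<Rightarrow> 's \<Rightarrow> 'k::field" where
  "block_entry v a b s = (if a * s * sinv b \<in> G then v (a * s * sinv b) else 0)"

text \<open>On the elements \<open>u \<le> t\<close> the block entry is constant for \<open>f * t \<le> u\<close>, where \<open>f = sinv a * a\<close>, and vanishes
  elsewhere. So the sum runs over the interval from \<open>f * t\<close> to \<open>t\<close>, and the Moebius function sums to zero
  unless this interval is a point.\<close>

lemma sum_floor_elt_block_entry: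
  fixes v :: "'s \<Rightarrow> 'k::field_char_0"
  assumes a: "a \<in> R_class" and b: "b \<in> R_class" and t: "t \<in> regulars"
  shows "(\<Sum>u\<in>regulars. floor_elt t u * block_entry v a b u) =
    (if sinv a * a * t = t then block_entry v a b t else 0)"
proof -
  note A = R_class_D[OF a]
  let ?f = "sinv a * a"
  have ft: "?f * t \<in> regulars" using regulars_mult idem_sinv(1)[OF A(9)] t by blast
  have aft: "a * (?f * t) * sinv b = a * t * sinv b"
    using A by (simp flip: mult.assoc)
  have le: "block_entry v a b u = (if reg_le (?f * t) u then block_entry v a b t else 0)"
    if u: "u \<in> regulars" "reg_le u t" for u
  proof -
    obtain h where h: "h \<in> idems" "u = h * t" using u by (auto simp: reg_le_def)
    show ?thesis
    proof (cases "a * u * sinv b \<in> G")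
      case True
      note * = translate_le[OF a b h(1) True[unfolded h(2)]]
      have "?f * t = ?f * u" unfolding h(2) using *(2) by (simp flip: mult.assoc)
      then have "reg_le (?f * t) u" using A(9) by (auto simp: reg_le_def)
      then show ?thesis using *(1) h(2) by (simp add: block_entry_def)
    next
      case False
      have "a * t * sinv b \<notin> G" if ftu: "reg_le (?f * t) u"
      proof
        assume g: "a * t * sinv b \<in> G"
        obtain k where k: "k \<in> idems" "?f * t = k * u" using ftu by (auto simp: reg_le_def)
        have "a * (k * u) * sinv b \<in> G" using g aft k(2) by simp
        from translate_le(1)[OF a b k(1) this] this False show False by simp
      qed
      then show ?thesis using False by (simp add: block_entry_def)
    qed
  qed
  have "(\<Sum>u\<in>regulars. floor_elt t u * block_entry v a b u) =
    (\<Sum>u\<in>{u\<in>regulars. reg_le (?f * t) u \<and> reg_le u t}. of_int (moebius regulars reg_le u t) * block_entry v a b t)"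
    by (rule sum.mono_neutral_cong_right) (auto simp: floor_elt_def le)
  also have "\<dots> = of_int (\<Sum>u\<in>{u\<in>regulars. reg_le (?f * t) u \<and> reg_le u t}. moebius regulars reg_le u t) * block_entry v a b t"
    by (simp add: sum_distrib_right)
  also have "\<dots> = of_int (if ?f * t = t then 1 else 0) * block_entry v a b t"
    by (subst moebius_lower_sum[OF partial_order_regulars[OF comm] ft t]) simp_all
  finally show ?thesis by simp
qed

text \<open>Of all \<open>t\<close> in the down-set of \<open>s\<close> only \<open>t = f * s\<close> with \<open>f = sinv a * a\<close> survives: a \<open>t\<close> with a nonzero term has
  range idempotent \<open>t * sinv t = f\<close>, and \<open>t * sinv t * s = t\<close>.\<close>

lemma sum_nu_block_entry:
  fixes v :: "'s \<Rightarrow> 'k::field_char_0"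
  assumes a: "a \<in> R_class" and b: "b \<in> R_class"
  shows "(\<Sum>u\<in>regulars. nu s u * block_entry v a b u) = block_entry v a b s"
proof -
  note A = R_class_D[OF a] and B = R_class_D[OF b]
  let ?f = "sinv a * a"
  have br: "sinv b \<in> regulars" "sinv (sinv b) = b" using sinv_regular[OF B(1)] by auto
  have "(\<Sum>u\<in>regulars. nu s u * block_entry v a b u) =
      (\<Sum>t\<in>down_set s. \<Sum>u\<in>regulars. floor_elt t u * block_entry v a b u)"
    unfolding nu_def sum_distrib_right by (rule sum.swap)
  also have "\<dots> = (\<Sum>t\<in>down_set s. if ?f * t = t then block_entry v a b t else 0)"
    by (intro sum.cong refl sum_floor_elt_block_entry[OF a b]) (simp add: down_set_def)
  also have "\<dots> = (\<Sum>t\<in>down_set s. if t = ?f * s then block_entry v a b s else 0)"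
  proof (rule sum.cong[OF refl])
    fix t assume "t \<in> down_set s"
    then have t: "t \<in> regulars" "t * sinv t * s = t" by (auto simp: down_set_def)
    show "(if ?f * t = t then block_entry v a b t else 0) = (if t = ?f * s then block_entry v a b s else 0)"
    proof (cases "t = ?f * s")
      case True
      have "?f * t = t" "a * t * sinv b = a * s * sinv b"
        unfolding True using A by (simp_all flip: mult.assoc) (simp_all add: mult.assoc)
      then show ?thesis using True by (simp add: block_entry_def)
    next
      case False
      have "\<not> (a * t * sinv b \<in> G)" if ft: "?f * t = t"
      proof
        assume "a * t * sinv b \<in> G"
        then have g: "a * (t * sinv b) \<in> G" by (simp add: mult.assoc)
        have "t * sinv b * e = t * sinv b" using B by (simp add: mult.assoc)
        from translate_in_G_D(2)[OF a this g]
        have f: "?f = t * (sinv b * b) * sinv t"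
          using regulars_mult(2)[OF t(1) br(1)] br(2) by (simp add: mult.assoc)
        have "?f * (t * sinv t) = ?f" unfolding f using sinv[OF t(1)] by (simp add: mult.assoc)
        then have "t * sinv t = ?f" using ft by (simp flip: mult.assoc)
        then show False using False t by simp
      qed
      then show ?thesis using False by (simp add: block_entry_def)
    qed
  qed
  also have "\<dots> = block_entry v a b s"
  proof (cases "a * s * sinv b \<in> G")
    case True
    let ?g = "a * s * sinv b"
    note G = G_D[OF True]
    have "a * s * (sinv b * sinv ?g) * (a * s) = ?g * sinv ?g * (a * s)" by (simp add: mult.assoc)
    then have 1: "a * s * (sinv b * sinv ?g) * (a * s) = a * s" unfolding G(2) using A by simp
    have "sinv b * sinv ?g * (a * s) * (sinv b * sinv ?g) = sinv b * (sinv ?g * ?g * sinv ?g)" by (simp add: mult.assoc)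
    then have 2: "sinv b * sinv ?g * (a * s) * (sinv b * sinv ?g) = sinv b * sinv ?g" unfolding G(3,6) .
    note 3 = sinv_eqI[OF 1 2]
    note 4 = regulars_mult[OF sinv_regular(1)[OF A(1)] 3(1)]
    have "?f * s * sinv (?f * s) = sinv a * (?g * sinv ?g) * a"
      using 4(2) unfolding 3(2) sinv_regular(2)[OF A(1)] by (simp add: mult.assoc)
    then have "?f * s * sinv (?f * s) * s = ?f * s" unfolding G(2) using A by (simp add: mult.assoc)
    then have "?f * s \<in> down_set s" using 4(1) by (simp add: down_set_def mult.assoc)
    then show ?thesis by (simp add: sum.delta)
  next
    case False
    then show ?thesis by (simp add: block_entry_def)
  qed
  finally show ?thesis .
qed

end

section \<open>The Moebius idempotent in a representation\<close>

lemma sandwich_linear_ext: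
  fixes \<rho> :: "'s::{semigroup_mult,finite} \<Rightarrow> 'k::field mat"
  assumes M: "M \<in> carrier_mat r k" and N: "N \<in> carrier_mat k c" and \<rho>: "\<And>u. \<rho> u \<in> carrier_mat k k"
    and ij: "i < r" "j < c"
  shows "(M * linear_ext k \<rho> a * N) $$ (i, j) = (\<Sum>u\<in>regulars. a u * (M * \<rho> u * N) $$ (i, j))"
proof -
  have L: "linear_ext k \<rho> a \<in> carrier_mat k k" by (simp add: linear_ext_def)
  have entry: "(M * A * N) $$ (i, j) = (\<Sum>y<k. \<Sum>x<k. M $$ (i, x) * A $$ (x, y) * N $$ (y, j))"
    if "A \<in> carrier_mat k k" for A
    unfolding mat_mult_entry[OF mult_carrier_mat[OF M that] N ij]
    by (rule sum.cong[OF refl]) (simp only: mat_mult_entry[OF M that ij(1)] sum_distrib_right lessThan_iff)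
  have "(M * linear_ext k \<rho> a * N) $$ (i, j) =
      (\<Sum>y<k. \<Sum>x<k. \<Sum>u\<in>regulars. a u * (M $$ (i, x) * \<rho> u $$ (x, y) * N $$ (y, j)))"
    unfolding entry[OF L] by (auto intro!: sum.cong simp: linear_ext_def sum_distrib_left sum_distrib_right ac_simps)
  also have "\<dots> = (\<Sum>y<k. \<Sum>u\<in>regulars. \<Sum>x<k. a u * (M $$ (i, x) * \<rho> u $$ (x, y) * N $$ (y, j)))"
    by (rule sum.cong[OF refl], rule sum.swap)
  also have "\<dots> = (\<Sum>u\<in>regulars. \<Sum>y<k. \<Sum>x<k. a u * (M $$ (i, x) * \<rho> u $$ (x, y) * N $$ (y, j)))"
    by (rule sum.swap)
  finally show ?thesis unfolding entry[OF \<rho>] by (simp add: sum_distrib_left)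
qed

text \<open>The vectors \<open>v\<close> with \<open>M \<sigma>(s) v = 0\<close> for all \<open>s\<close> form an invariant subspace. If it contained an image
  of \<open>N\<close> it would be everything; but then the kernel of \<open>M\<close> would be invariant, hence zero, and every
  \<open>\<sigma>(s)\<close> would vanish.\<close>

lemma irreducible_sandwich:
  fixes \<sigma> :: "'s::semigroup_mult \<Rightarrow> 'k::field mat"
  assumes irr: "irreducible_rep UNIV k \<sigma>" and nonnull: "\<sigma> s0 \<noteq> 0\<^sub>m k k"
    and M: "M \<in> carrier_mat r k" "M \<noteq> 0\<^sub>m r k" and N: "N \<in> carrier_mat k c" "N \<noteq> 0\<^sub>m k c"
  shows "\<exists>s. M * \<sigma> s * N \<noteq> 0\<^sub>m r c"
proof (rule ccontr)
  assume "\<nexists>s. M * \<sigma> s * N \<noteq> 0\<^sub>m r c"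
  then have z: "M * \<sigma> s * N = 0\<^sub>m r c" for s by blast
  have \<sigma>: "\<sigma> s \<in> carrier_mat k k" "\<sigma> (s * t) = \<sigma> s * \<sigma> t" for s t
    using irr by (auto simp: irreducible_rep_def mat_rep_def)
  have \<sigma>v: "\<sigma> s *\<^sub>v v \<in> carrier_vec k" if "v \<in> carrier_vec k" for s v
    using \<sigma>(1) that by (rule mult_mat_vec_carrier)
  have simple: "W = {0\<^sub>v k} \<or> W = carrier_vec k"
    if "subspace class_ring W (module_vec TYPE('k) k)" "\<And>s w. w \<in> W \<Longrightarrow> \<sigma> s *\<^sub>v w \<in> W" for W
    using irr that by (auto simp: irreducible_rep_def)
  obtain v where v: "v \<in> carrier_vec c" "N *\<^sub>v v \<noteq> 0\<^sub>v k"
    using mat_eq_0_if_kills_vecs N by blast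
  let ?W = "{v \<in> carrier_vec k. \<forall>s. M *\<^sub>v (\<sigma> s *\<^sub>v v) = 0\<^sub>v r}"
  have "?W = {0\<^sub>v k} \<or> ?W = carrier_vec k"
  proof (rule simple)
    show "subspace class_ring ?W (module_vec TYPE('k) k)"
      by (rule subspaceI_vec)
        (use \<sigma>v in \<open>auto simp: mult_zero_vec[OF \<sigma>(1)] mult_zero_vec[OF M(1)] mult_add_distrib_mat_vec[OF \<sigma>(1)] mult_mat_vec[OF \<sigma>(1)]
          mult_add_distrib_mat_vec[OF M(1)] mult_mat_vec[OF M(1)]\<close>)
    show "\<sigma> s *\<^sub>v w \<in> ?W" if "w \<in> ?W" for s w
    proof -
      have "\<sigma> t *\<^sub>v (\<sigma> s *\<^sub>v w) = \<sigma> (t * s) *\<^sub>v w" for t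
        unfolding \<sigma>(2) using that by (intro assoc_mult_mat_vec[OF \<sigma>(1) \<sigma>(1), symmetric]) simp
      then show ?thesis using that \<sigma>v by simp
    qed
  qed
  moreover have "N *\<^sub>v v \<in> ?W"
  proof -
    have "M *\<^sub>v (\<sigma> s *\<^sub>v (N *\<^sub>v v)) = M * \<sigma> s * N *\<^sub>v v" for s
      using M N \<sigma>(1)[of s] v by (simp add: assoc_mult_mat_vec[of _ r k _ c] assoc_mult_mat_vec[of _ r k _ k])
    moreover have "0\<^sub>m r c *\<^sub>v v = 0\<^sub>v r" using v by (intro eq_vecI) auto
    ultimately show ?thesis unfolding z using v mult_mat_vec_carrier[OF N(1)] by simp
  qed
  ultimately have W: "M *\<^sub>v (\<sigma> s *\<^sub>v w) = 0\<^sub>v r" if "w \<in> carrier_vec k" for s w using v that by blast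
  let ?K = "{v \<in> carrier_vec k. M *\<^sub>v v = 0\<^sub>v r}"
  have "?K = {0\<^sub>v k} \<or> ?K = carrier_vec k"
    by (rule simple[OF subspace_kernel[OF M(1)]]) (use W \<sigma>v in auto)
  moreover have "?K \<noteq> carrier_vec k" using mat_eq_0_if_kills_vecs[OF M(1)] M(2) by blast
  moreover obtain w where "w \<in> carrier_vec k" "\<sigma> s0 *\<^sub>v w \<noteq> 0\<^sub>v k"
    using mat_eq_0_if_kills_vecs[OF \<sigma>(1)] nonnull by blast
  then have "?K \<noteq> {0\<^sub>v k}" using W \<sigma>v by blast
  ultimately show False by blast
qed

locale representation_at = commuting_idempotents_at e
  for e :: "'s::{semigroup_mult,finite}" +
  fixes k :: nat and \<sigma> :: "'s \<Rightarrow> 'k::field_char_0 mat"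
  assumes rep: "mat_rep UNIV k \<sigma>"
begin

lemma \<sigma>_carrier [simp]: "\<sigma> s \<in> carrier_mat k k" "dim_row (\<sigma> s) = k" "dim_col (\<sigma> s) = k"
  using rep by (auto simp: mat_rep_def)

lemma \<sigma>_mult: "\<sigma> (s * t) = \<sigma> s * \<sigma> t"
  using rep by (simp add: mat_rep_def)

text \<open>The matrix \<open>\<sigma>(\<eta>)\<close>. Idempotents are regular, so the sum over regular elements in \<open>linear_ext\<close> loses nothing.\<close>

definition eta :: "'k mat" where "eta = linear_ext k \<sigma> (idem_coeff e)"

lemma eta_carrier [simp]: "eta \<in> carrier_mat k k" "dim_row eta = k" "dim_col eta = k"
  by (simp_all add: eta_def linear_ext_def)

lemma sandwich_eta:
  assumes "M \<in> carrier_mat r k" "N \<in> carrier_mat k c" "i < r" "j < c"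
  shows "(M * eta * N) $$ (i, j) = (\<Sum>u\<in>UNIV. idem_coeff e u * (M * \<sigma> u * N) $$ (i, j))"
  unfolding eta_def sandwich_linear_ext[OF assms(1,2) \<sigma>_carrier(1) assms(3,4)]
  by (rule sum.mono_neutral_left) (auto simp: idem_coeff_def idem_sinv(1))

lemma sandwich_eta_zero:
  assumes M: "M \<in> carrier_mat r k" and N: "N \<in> carrier_mat k c"
    and z: "\<And>f. f \<in> idems \<Longrightarrow> idem_le f e \<Longrightarrow> M * \<sigma> f * N = 0\<^sub>m r c"
  shows "M * eta * N = 0\<^sub>m r c"
proof (rule eq_matI)
  fix i j assume "i < dim_row (0\<^sub>m r c :: 'k mat)" "j < dim_col (0\<^sub>m r c :: 'k mat)"
  then have ij: "i < r" "j < c" by auto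
  show "(M * eta * N) $$ (i, j) = 0\<^sub>m r c $$ (i, j)"
    unfolding sandwich_eta[OF M N ij] using z ij by (auto simp: idem_coeff_def intro!: sum.neutral)
qed (use M N in auto)

text \<open>The coefficient of \<open>e\<close> in \<open>\<eta>\<close> is 1.\<close>

lemma sandwich_eta_only_e:
  assumes M: "M \<in> carrier_mat r k" and N: "N \<in> carrier_mat k c"
    and z: "\<And>f. f \<in> idems \<Longrightarrow> idem_le f e \<Longrightarrow> f \<noteq> e \<Longrightarrow> M * \<sigma> f * N = 0\<^sub>m r c"
  shows "M * eta * N = M * \<sigma> e * N"
proof (rule eq_matI)
  fix i j assume "i < dim_row (M * \<sigma> e * N)" "j < dim_col (M * \<sigma> e * N)"
  then have ij: "i < r" "j < c" using M N by auto
  have "(\<Sum>u\<in>UNIV. idem_coeff e u * (M * \<sigma> u * N) $$ (i, j)) =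
      (\<Sum>u\<in>{e}. idem_coeff e u * (M * \<sigma> u * N) $$ (i, j))"
    using z ij by (intro sum.mono_neutral_right) (auto simp: idem_coeff_def)
  then show "(M * eta * N) $$ (i, j) = (M * \<sigma> e * N) $$ (i, j)"
    unfolding sandwich_eta[OF M N ij] by (simp add: idem_coeff_e)
qed (use M N in auto)

lemma eta_e: "eta * \<sigma> e = eta" "\<sigma> e * eta = eta"
proof -
  have *: "\<sigma> u * \<sigma> e = \<sigma> u" "\<sigma> e * \<sigma> u = \<sigma> u" if "idem_coeff e u \<noteq> (0::'k)" for u
    using that unfolding \<sigma>_mult[symmetric] by (auto simp: idem_coeff_def idem_le_def split: if_splits)
  have 0: "eta = 1\<^sub>m k * eta * 1\<^sub>m k" by simp
  show "eta * \<sigma> e = eta"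
  proof (rule eq_matI)
    fix i j assume "i < dim_row eta" "j < dim_col eta"
    then have ij: "i < k" "j < k" by auto
    have "(1\<^sub>m k * eta * \<sigma> e) $$ (i, j) = (1\<^sub>m k * eta * 1\<^sub>m k) $$ (i, j)"
      unfolding sandwich_eta[OF one_carrier_mat \<sigma>_carrier(1) ij] sandwich_eta[OF one_carrier_mat one_carrier_mat ij]
      by (rule sum.cong[OF refl]) (use * in force)
    then show "(eta * \<sigma> e) $$ (i, j) = eta $$ (i, j)" by simp
  qed auto
  show "\<sigma> e * eta = eta"
  proof (rule eq_matI)
    fix i j assume "i < dim_row eta" "j < dim_col eta"
    then have ij: "i < k" "j < k" by auto
    have "(\<sigma> e * eta * 1\<^sub>m k) $$ (i, j) = (1\<^sub>m k * eta * 1\<^sub>m k) $$ (i, j)"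
      unfolding sandwich_eta[OF \<sigma>_carrier(1) one_carrier_mat ij] sandwich_eta[OF one_carrier_mat one_carrier_mat ij]
      by (rule sum.cong[OF refl]) (use * in force)
    then show "(\<sigma> e * eta) $$ (i, j) = eta $$ (i, j)" by simp
  qed auto
qed

lemma eta_kill:
  assumes h: "h \<in> idems" and he: "e * h \<noteq> e"
  shows "eta * \<sigma> h = 0\<^sub>m k k" "\<sigma> h * eta = 0\<^sub>m k k"
proof -
  have 1: "(\<Sum>u\<in>UNIV. idem_coeff e u * \<sigma> (u * h) $$ ij) = 0" for ij
  proof -
    have "(\<Sum>u\<in>UNIV. idem_coeff e u * \<sigma> (u * h) $$ ij) =
        (\<Sum>x\<in>UNIV. \<Sum>u\<in>{u\<in>UNIV. u * h = x}. idem_coeff e u * \<sigma> (u * h) $$ ij)"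
      by (rule sum.group[symmetric]) auto
    also have "\<dots> = (\<Sum>x\<in>UNIV. (\<Sum>u\<in>{u. u * h = x}. idem_coeff e u) * \<sigma> x $$ ij)"
      by (simp add: sum_distrib_right)
    finally show ?thesis by (simp add: idem_coeff_annihilates[OF h he])
  qed
  have 2: "idem_coeff e u * \<sigma> (h * u) $$ ij = idem_coeff e u * \<sigma> (u * h) $$ ij" for u ij
    using comm[OF h] by (auto simp: idem_coeff_def)
  have 3: "(\<Sum>u\<in>UNIV. idem_coeff e u * \<sigma> (h * u) $$ ij) = 0" for ij
    unfolding 2 by (rule 1)
  show "eta * \<sigma> h = 0\<^sub>m k k"
  proof (rule eq_matI)
    fix i j assume "i < dim_row (0\<^sub>m k k :: 'k mat)" "j < dim_col (0\<^sub>m k k :: 'k mat)"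
    then have ij: "i < k" "j < k" by auto
    have "(1\<^sub>m k * eta * \<sigma> h) $$ (i, j) = 0"
      unfolding sandwich_eta[OF one_carrier_mat \<sigma>_carrier(1) ij] using 1[of "(i,j)"] by (simp add: \<sigma>_mult)
    then show "(eta * \<sigma> h) $$ (i, j) = 0\<^sub>m k k $$ (i, j)" using ij by simp
  qed auto
  show "\<sigma> h * eta = 0\<^sub>m k k"
  proof (rule eq_matI)
    fix i j assume "i < dim_row (0\<^sub>m k k :: 'k mat)" "j < dim_col (0\<^sub>m k k :: 'k mat)"
    then have ij: "i < k" "j < k" by auto
    have "(\<sigma> h * eta * 1\<^sub>m k) $$ (i, j) = 0"
      unfolding sandwich_eta[OF \<sigma>_carrier(1) one_carrier_mat ij]
      using 3[of "(i,j)"] by (simp add: \<sigma>_mult[symmetric])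
    then show "(\<sigma> h * eta) $$ (i, j) = 0\<^sub>m k k $$ (i, j)" using ij by simp
  qed auto
qed

lemma eta_idem: "eta * eta = eta"
proof -
  have "eta * eta * 1\<^sub>m k = eta * \<sigma> e * 1\<^sub>m k"
  proof (rule sandwich_eta_only_e)
    fix f assume "f \<in> idems" "idem_le f e" "f \<noteq> e"
    then show "eta * \<sigma> f * 1\<^sub>m k = 0\<^sub>m k k" using eta_kill[of f] by (simp add: idem_le_def)
  qed auto
  then show ?thesis by (simp add: eta_e right_mult_one_mat')
qed

text \<open>Conjugation by \<open>g \<in> G\<close> permutes the idempotents strictly below \<open>e\<close>, and these are annihilated by \<open>\<eta>\<close>. So
  expanding the first factor \<open>\<eta>\<close> of \<open>g \<eta> g\<inverse> \<eta>\<close> gives \<open>\<eta>\<close>, and expanding the second gives \<open>g \<eta> g\<inverse>\<close>.\<close>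

lemma eta_commutes:
  assumes g: "g \<in> G" shows "\<sigma> g * eta = eta * \<sigma> g"
proof -
  note G = G_D[OF g]
  let ?g' = "sinv g"
  note assoc = mat_mult_assoc
  have conj: "x * f * sinv x \<in> idems" "e * (x * f * sinv x) = x * f * sinv x" "x * f * sinv x \<noteq> e"
    if "x \<in> G" "f \<in> idems" "idem_le f e" "f \<noteq> e" for x f
  proof -
    note X = G_D[OF that(1)]
    have f: "e * f = f" "f * e = f" "f * f = f" "f * (f * y) = f * y" for y
      using that by (auto simp: idem_le_def idems_def simp flip: mult.assoc)
    have ef: "e * (f * y) = f * y" for y using f by (simp flip: mult.assoc)
    show "x * f * sinv x \<in> idems" "e * (x * f * sinv x) = x * f * sinv x"
      using X f ef by (simp_all add: idems_def mult.assoc)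
    show "x * f * sinv x \<noteq> e"
    proof
      assume "x * f * sinv x = e"
      then have "sinv x * (x * f * sinv x) * x = sinv x * e * x" by simp
      then show False using X f ef that(4) by (simp add: mult.assoc)
    qed
  qed
  have "\<sigma> g * eta * (\<sigma> ?g' * eta) = \<sigma> g * \<sigma> e * (\<sigma> ?g' * eta)"
  proof (rule sandwich_eta_only_e)
    fix f assume f: "f \<in> idems" "idem_le f e" "f \<noteq> e"
    note c = conj[OF g f]
    have "\<sigma> g * \<sigma> f * (\<sigma> ?g' * eta) = \<sigma> (g * f * ?g') * eta" by (simp add: \<sigma>_mult assoc)
    then show "\<sigma> g * \<sigma> f * (\<sigma> ?g' * eta) = 0\<^sub>m k k" using eta_kill(2)[OF c(1)] c(2,3) by simp
  qed auto
  also have "\<dots> = \<sigma> (g * e * ?g') * eta" by (simp add: \<sigma>_mult assoc)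
  also have "\<dots> = eta" using G by (simp add: eta_e mult.assoc)
  finally have 1: "\<sigma> g * eta * (\<sigma> ?g' * eta) = eta" .
  have "\<sigma> g * eta * \<sigma> ?g' * eta * 1\<^sub>m k = \<sigma> g * eta * \<sigma> ?g' * \<sigma> e * 1\<^sub>m k"
  proof (rule sandwich_eta_only_e)
    fix f assume f: "f \<in> idems" "idem_le f e" "f \<noteq> e"
    note c = conj[OF G_sinv(1)[OF g] f]
    have fe: "f * e = f" using f by (simp add: idem_le_def)
    have "?g' * f = ?g' * f * sinv ?g' * ?g'" using G fe by (simp add: mult.assoc G_sinv[OF g])
    then have "\<sigma> g * eta * \<sigma> ?g' * \<sigma> f = \<sigma> g * (eta * \<sigma> (?g' * f * sinv ?g')) * \<sigma> ?g'"
      by (simp add: assoc) (metis \<sigma>_mult)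
    also have "\<dots> = 0\<^sub>m k k" using eta_kill(1)[OF c(1)] c(2,3) by simp
    finally show "\<sigma> g * eta * \<sigma> ?g' * \<sigma> f * 1\<^sub>m k = 0\<^sub>m k k" by simp
  qed auto
  then have "\<sigma> g * eta * \<sigma> ?g' * eta = \<sigma> g * eta * \<sigma> (?g' * e)"
    by (simp add: right_mult_one_mat' \<sigma>_mult assoc)
  then have 2: "\<sigma> g * eta * \<sigma> ?g' = eta" using 1 G by (simp add: assoc)
  have "\<sigma> g * eta = \<sigma> g * (eta * \<sigma> (?g' * g))" using G by (simp add: eta_e)
  also have "\<dots> = \<sigma> g * eta * \<sigma> ?g' * \<sigma> g" by (simp add: assoc \<sigma>_mult)
  finally show ?thesis unfolding 2 .
qed

end

section \<open>Irreducible representations not annihilated by the Moebius idempotent\<close>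

locale irreducible_representation_at = representation_at e k \<sigma>
  for e :: "'s::{semigroup_mult,finite}" and k and \<sigma> :: "'s \<Rightarrow> 'k::field_char_0 mat" +
  assumes irr: "irreducible_rep UNIV k \<sigma>"
begin

lemma eta_sandwich_nonzero:
  assumes "eta \<noteq> 0\<^sub>m k k" "M \<in> carrier_mat r k" "M \<noteq> 0\<^sub>m r k" "N \<in> carrier_mat k c" "N \<noteq> 0\<^sub>m k c"
  obtains s where "M * \<sigma> s * N \<noteq> 0\<^sub>m r c"
proof -
  have "\<sigma> e \<noteq> 0\<^sub>m k k" using assms(1) eta_e(1) by (metis eta_carrier(1) right_mult_zero_mat)
  from irreducible_sandwich[OF irr this assms(2-5)] show ?thesis using that by blast
qed

text \<open>Among the right multiples \<open>u\<close> of \<open>t\<close> with \<open>\<sigma>(\<eta>u) \<noteq> 0\<close> choose one with a smallest right ideal \<open>uS\<close>. By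
  irreducibility \<open>\<sigma>(\<eta>usfu) \<noteq> 0\<close> for suitable \<open>s\<close> and \<open>f\<close>, so minimality gives \<open>u = (usf)uy\<close>. A finite
  semigroup of such left factors contains an idempotent \<open>i \<in> uS\<close> with \<open>iu = u\<close>. From \<open>\<sigma>(\<eta>i) \<noteq> 0\<close> it follows that
  \<open>e \<le> i\<close>, and so \<open>e = ei\<close> lies in \<open>euS \<subseteq> etS\<close>.\<close>

lemma right_inverse_if_eta_nonzero:
  assumes "eta * \<sigma> t \<noteq> 0\<^sub>m k k"
  shows "\<exists>w. e * t * w = e"
proof -
  note assoc = mat_mult_assoc
  have eta0: "eta \<noteq> 0\<^sub>m k k" using assms by (metis left_mult_zero_mat \<sigma>_carrier(1))
  define U where "U = {u. eta * \<sigma> u \<noteq> 0\<^sub>m k k \<and> (\<exists>r. u = t * r)}"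
  have ext: "\<exists>s. eta * \<sigma> (u * s) \<noteq> 0\<^sub>m k k" if nz: "eta * \<sigma> u \<noteq> 0\<^sub>m k k" for u
  proof -
    have "(1\<^sub>m k :: 'k mat) \<noteq> 0\<^sub>m k k" using nz \<sigma>_carrier(1)[of u] eta_carrier(1)
      by (metis left_mult_one_mat left_mult_zero_mat mult_carrier_mat)
    from eta_sandwich_nonzero[OF eta0 mult_carrier_mat[OF eta_carrier(1) \<sigma>_carrier(1)] nz one_carrier_mat this]
    obtain s where "eta * \<sigma> u * \<sigma> s * 1\<^sub>m k \<noteq> 0\<^sub>m k k" by blast
    then show ?thesis by (intro exI[of _ s]) (simp add: \<sigma>_mult assoc right_mult_one_mat')
  qed
  have U_ext: "u * x \<in> U" if "u \<in> U" "eta * \<sigma> (u * x) \<noteq> 0\<^sub>m k k" for u x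
    using that by (auto simp: U_def mult.assoc)
  obtain s where "t * s \<in> U" using ext[OF assms] by (auto simp: U_def)
  from ex_has_least_nat[of "\<lambda>u. u \<in> U" "t * s" "\<lambda>u. card (range ((*) u))", OF this]
  obtain u0 where u0: "u0 \<in> U" and least: "\<And>y. y \<in> U \<Longrightarrow> card (range ((*) u0)) \<le> card (range ((*) y))" by blast
  have same_ideal: "range ((*) (u0 * x)) = range ((*) u0)" if "u0 * x \<in> U" for x
    by (rule card_subset_eq) (use least[OF that] in \<open>auto simp: mult.assoc intro!: antisym card_mono\<close>)
  \<comment> \<open>Replacing \<open>u0\<close> by \<open>u0 * s0\<close> keeps the ideal and makes it contain its generator.\<close>
  obtain s0 where "eta * \<sigma> (u0 * s0) \<noteq> 0\<^sub>m k k" using ext[of u0] u0 by (auto simp: U_def)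
  then have s0: "u0 * s0 \<in> U" by (rule U_ext[OF u0])
  define u where "u = u0 * s0"
  have u: "u \<in> U" "eta * \<sigma> u \<noteq> 0\<^sub>m k k" using s0 by (auto simp: u_def U_def)
  obtain s1 where s1: "eta * \<sigma> u * \<sigma> s1 * (eta * \<sigma> u) \<noteq> 0\<^sub>m k k"
    by (rule eta_sandwich_nonzero[OF eta0 _ u(2) _ u(2)]) auto
  have "\<exists>f. eta * \<sigma> u * \<sigma> s1 * \<sigma> f * \<sigma> u \<noteq> 0\<^sub>m k k"
  proof (rule ccontr)
    assume "\<nexists>f. eta * \<sigma> u * \<sigma> s1 * \<sigma> f * \<sigma> u \<noteq> 0\<^sub>m k k"
    then have "eta * \<sigma> u * \<sigma> s1 * eta * \<sigma> u = 0\<^sub>m k k" by (intro sandwich_eta_zero) auto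
    then show False using s1 by (simp add: assoc)
  qed
  then obtain f where "eta * \<sigma> u * \<sigma> s1 * \<sigma> f * \<sigma> u \<noteq> 0\<^sub>m k k" by blast
  then have "eta * \<sigma> (u * (s1 * f * u)) \<noteq> 0\<^sub>m k k" by (simp add: \<sigma>_mult assoc)
  from U_ext[OF u(1) this] have "range ((*) (u * (s1 * f * u))) = range ((*) u0)"
    using same_ideal[of "s0 * (s1 * f * u)"] by (simp add: u_def mult.assoc)
  then have "u \<in> range ((*) (u * (s1 * f * u)))" by (simp add: u_def)
  then obtain y where y: "u = u * (s1 * f) * u * y" by (auto simp: mult.assoc)
  let ?C = "{x. (\<exists>z. x * u * z = u) \<and> (\<exists>z. x = u * z)}"
  have "\<exists>i\<in>?C. i * i = i"
  proof (rule finite_subsemigroup_has_idempotent)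
    have "u * (s1 * f) * u * y = u" by (rule y[symmetric])
    then show "?C \<noteq> {}" by blast
    fix x1 x2 assume x: "x1 \<in> ?C" "x2 \<in> ?C"
    then obtain z1 z2 v where z: "x1 * u * z1 = u" "x2 * u * z2 = u" "x1 = u * v" by blast
    have "x1 * x2 * u * (z2 * z1) = x1 * (x2 * u * z2) * z1" by (simp add: mult.assoc)
    also have "\<dots> = u" using z by simp
    finally show "x1 * x2 \<in> ?C" using z(3) by (auto simp: mult.assoc)
  qed
  then obtain i z v where i: "i * i = i" "i * u * z = u" "i = u * v" by blast
  have "i * u = i * (i * u * z)" by (simp only: i(2))
  also have "\<dots> = i * i * u * z" by (simp add: mult.assoc)
  finally have iu: "i * u = u" by (simp only: i(1,2))
  have "eta * \<sigma> i \<noteq> 0\<^sub>m k k"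
  proof
    assume "eta * \<sigma> i = 0\<^sub>m k k"
    then have "eta * \<sigma> i * \<sigma> u = 0\<^sub>m k k" by (simp add: left_mult_zero_mat)
    then show False using u(2) iu by (simp add: assoc flip: \<sigma>_mult)
  qed
  then have "e * i = e" using eta_kill(1)[of i] i(1) by (auto simp: idems_def)
  moreover obtain r where "u = t * r" using u(1) by (auto simp: U_def)
  ultimately show ?thesis using i(3) by (intro exI[of _ "r * v"]) (simp add: mult.assoc)
qed

lemma eta_kill_nonunit:
  assumes b: "e * b = b" "b * e = b" and "b \<notin> G"
  shows "eta * \<sigma> b = 0\<^sub>m k k"
proof (rule ccontr)
  assume "eta * \<sigma> b \<noteq> 0\<^sub>m k k"
  then obtain w where "e * b * w = e" using right_inverse_if_eta_nonzero by blast
  then show False using right_invertible_in_G[OF b, of w] b assms(3) by simp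
qed

text \<open>If \<open>\<sigma>(y\<eta>) \<noteq> 0\<close>, then \<open>\<sigma>(\<eta>cy\<eta>) \<noteq> 0\<close> for some \<open>c\<close> by irreducibility, so \<open>ecy\<close> is a unit of \<open>eSe\<close> and \<open>y\<close> is in the
  Green class.\<close>

lemma kill_eta_outside_L_class:
  assumes y: "y * e = y" and nL: "y \<notin> L_class"
  shows "\<sigma> y * eta = 0\<^sub>m k k"
proof (rule ccontr)
  assume nz: "\<sigma> y * eta \<noteq> 0\<^sub>m k k"
  note assoc = mat_mult_assoc
  have eta0: "eta \<noteq> 0\<^sub>m k k" using nz by (metis right_mult_zero_mat \<sigma>_carrier(1))
  obtain c where "eta * \<sigma> c * (\<sigma> y * eta) \<noteq> 0\<^sub>m k k"
    by (rule eta_sandwich_nonzero[OF eta0 _ eta0 _ nz]) auto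
  moreover have "eta * \<sigma> c * (\<sigma> y * eta) = eta * \<sigma> e * \<sigma> c * (\<sigma> y * eta)" by (simp add: eta_e)
  then have "eta * \<sigma> c * (\<sigma> y * eta) = eta * \<sigma> (e * c * y) * eta" by (simp add: assoc \<sigma>_mult)
  ultimately have "eta * \<sigma> (e * c * y) \<noteq> 0\<^sub>m k k" using left_mult_zero_mat[OF eta_carrier(1)] by metis
  then have "e * c * y \<in> G" using eta_kill_nonunit[of "e * c * y"] y by (auto simp: mult.assoc)
  from L_class_if_translate_in_G(1)[OF _ y this] nL show False by (simp add: mult.assoc)
qed

end

section \<open>Comparison with the associated representation\<close>

locale associated_representation = commuting_idempotents_at e
  for e :: "'s::{semigroup_mult,finite}" +
  fixes n :: nat and \<phi> :: "'s \<Rightarrow> 'k::field_char_0 mat" and p :: "'s \<Rightarrow> 's" and fs :: "'s list"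
  assumes \<phi>: "irreducible_group_rep e n \<phi>"
    and p: "\<And>f. f \<in> index_idems e \<Longrightarrow> p f \<in> regulars \<and> p f * sinv (p f) = e \<and> sinv (p f) * p f = f"
    and fs: "distinct fs" "set fs = index_idems e"
begin

abbreviation \<phi>_star_nu :: "'s \<Rightarrow> 'k mat" where "\<phi>_star_nu \<equiv> assoc_rep n \<phi> p fs"

lemma \<phi>_G:
  assumes "g \<in> G" shows "\<phi> g \<in> carrier_mat n n" "dim_row (\<phi> g) = n" "dim_col (\<phi> g) = n"
    "h \<in> G \<Longrightarrow> \<phi> (g * h) = \<phi> g * \<phi> h"
  using \<phi> assms by (auto simp: irreducible_group_rep_def irreducible_rep_def mat_rep_def)

lemma \<phi>_e: "\<phi> e = 1\<^sub>m n" and n_pos: "n > 0"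
  using \<phi> by (auto simp: irreducible_group_rep_def irreducible_rep_def)

lemma p_fs:
  assumes "c < length fs"
  shows "p (fs ! c) \<in> R_class" "sinv (p (fs ! c)) * p (fs ! c) = fs ! c"
proof -
  have "fs ! c \<in> index_idems e" using fs(2) nth_mem[OF assms] by blast
  from p[OF this] show "p (fs ! c) \<in> R_class" "sinv (p (fs ! c)) * p (fs ! c) = fs ! c"
    unfolding R_class_def by blast+
qed

lemma div_less: "i < length fs * n \<Longrightarrow> i div n < length fs"
  by (simp add: less_mult_imp_div_less)

lemma assoc_rep_entry:
  assumes i: "i < length fs * n" and j: "j < length fs * n"
  shows "\<phi>_star_nu s $$ (i, j) =
    block_entry (\<lambda>g. \<phi> g $$ (i mod n, j mod n)) (p (fs ! (i div n))) (p (fs ! (j div n))) s"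
proof -
  note pi = p_fs[OF div_less[OF i]] and pj = p_fs[OF div_less[OF j]]
  have "phi_star n \<phi> p fs u $$ (i, j) =
      block_entry (\<lambda>g. \<phi> g $$ (i mod n, j mod n)) (p (fs ! (i div n))) (p (fs ! (j div n))) u"
    if "u \<in> regulars" for u
    using phi_star_condition[OF that pi(1) pj(1)] i j pi(2) pj(2)
    by (simp add: phi_star_def block_entry_def Let_def)
  then show ?thesis
    using sum_nu_block_entry[OF pi(1) pj(1)] i j by (simp add: assoc_rep_def linear_ext_def)
qed

lemma assoc_rep_carrier [simp]:
  "\<phi>_star_nu s \<in> carrier_mat (length fs * n) (length fs * n)"
  "dim_row (\<phi>_star_nu s) = length fs * n" "dim_col (\<phi>_star_nu s) = length fs * n"
  by (simp_all add: assoc_rep_def linear_ext_def)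

lemma e_in_fs: "e \<in> set fs"
proof -
  have "e \<in> L_class" using G_e idem_sinv(1)[OF e_idem] by (simp add: L_class_def)
  then show ?thesis unfolding fs(2) index_idems_eq using G_e(2) by force
qed

end

text \<open>\<open>X\<close> is a nonzero \<open>G\<close>-equivariant map from the module of \<open>\<phi>\<close> into \<open>\<eta>V\<close>, where \<open>V\<close> is the module of an
  irreducible representation \<open>\<sigma>\<close>.\<close>

locale comparison = associated_representation e n \<phi> p fs + irreducible_representation_at e k \<sigma>
  for e :: "'s::{semigroup_mult,finite}" and n and \<phi> :: "'s \<Rightarrow> 'k::field_char_0 mat" and p fs k and \<sigma> :: "'s \<Rightarrow> 'k mat" +
  fixes X :: "'k mat"
  assumes X: "X \<in> carrier_mat k n" "X \<noteq> 0\<^sub>m k n" "eta * X = X"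
    and X_G: "\<And>g. g \<in> G \<Longrightarrow> \<sigma> g * X = X * \<phi> g"
begin

abbreviation q where "q j \<equiv> p (fs ! (j div n))"

definition intertwiner :: "'k mat" where
  "intertwiner = mat k (length fs * n) (\<lambda>(a, j). (\<sigma> (sinv (q j)) * X) $$ (a, j mod n))"

lemma intertwiner_carrier [simp]: "intertwiner \<in> carrier_mat k (length fs * n)"
  by (simp add: intertwiner_def)

lemma dims [simp]: "dim_row X = k" "dim_col X = n" "dim_row intertwiner = k" "dim_col intertwiner = length fs * n"
  using X by (auto simp: intertwiner_def)

lemma mult_intertwiner_entry:
  assumes M: "M \<in> carrier_mat k k" and a: "a < k" and j: "j < length fs * n"
  shows "(M * intertwiner) $$ (a, j) = (M * \<sigma> (sinv (q j)) * X) $$ (a, j mod n)"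
proof -
  have jn: "j mod n < n" using n_pos by simp
  have "(M * intertwiner) $$ (a, j) = (\<Sum>x<k. M $$ (a, x) * (\<sigma> (sinv (q j)) * X) $$ (x, j mod n))"
    unfolding mat_mult_entry[OF M intertwiner_carrier a j]
    by (rule sum.cong[OF refl]) (use j in \<open>simp add: intertwiner_def del: index_mult_mat\<close>)
  also have "\<dots> = (M * (\<sigma> (sinv (q j)) * X)) $$ (a, j mod n)"
    by (rule mat_mult_entry[OF M mult_carrier_mat[OF \<sigma>_carrier(1) X(1)] a jn, symmetric])
  finally show ?thesis using M by (simp add: mat_mult_assoc del: index_mult_mat(1))
qed

text \<open>The intertwiner is the block row with blocks \<open>\<sigma>(p\<^sub>f\<inverse>) X\<close>. In column block \<open>f'\<close> put \<open>y = s p\<^sub>f\<^sub>'\<inverse>\<close>. The left side is \<open>\<sigma>(y) X\<close>. On the right, the row block of \<open>f\<close> contributes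
  \<open>\<sigma>(p\<^sub>f\<inverse>) X \<phi>(p\<^sub>f y) = \<sigma>(p\<^sub>f\<inverse> p\<^sub>f y) X = \<sigma>(y) X\<close> if \<open>p\<^sub>f y \<in> G\<close>, and nothing otherwise. There is exactly one such \<open>f\<close> if \<open>y\<close>
  is in the Green class of \<open>e\<close>; for all other \<open>y\<close> there is none, and \<open>\<sigma>(y) X = \<sigma>(y\<eta>) X = 0\<close>.\<close>

lemma intertwiner_commutes: "\<sigma> s * intertwiner = intertwiner * \<phi>_star_nu s"
proof (rule eq_matI)
  fix a j assume "a < dim_row (intertwiner * \<phi>_star_nu s)" "j < dim_col (intertwiner * \<phi>_star_nu s)"
  then have a: "a < k" and j: "j < length fs * n" using assoc_rep_carrier[of s] by auto
  have jn: "j mod n < n" using n_pos by simp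
  let ?b = "sinv (q j)"
  let ?y = "s * ?b"
  have b: "?b * e = ?b" using R_class_D(4) p_fs(1)[OF div_less[OF j]] by blast
  have y: "?y * e = ?y" using b by (simp add: mult.assoc)
  let ?V = "(\<sigma> ?y * X) $$ (a, j mod n)"
  have block: "(\<Sum>r<n. (\<sigma> (sinv (p (fs ! c))) * X) $$ (a, r) *
      block_entry (\<lambda>g. \<phi> g $$ (r, j mod n)) (p (fs ! c)) (q j) s) = (if p (fs ! c) * ?y \<in> G then ?V else 0)"
    if c: "c < length fs" for c
  proof (cases "p (fs ! c) * ?y \<in> G")
    case True
    let ?a = "p (fs ! c)"
    have "(\<Sum>r<n. (\<sigma> (sinv ?a) * X) $$ (a, r) * \<phi> (?a * ?y) $$ (r, j mod n)) =
        (\<sigma> (sinv ?a) * X * \<phi> (?a * ?y)) $$ (a, j mod n)"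
      by (rule mat_mult_entry[OF mult_carrier_mat[OF \<sigma>_carrier(1) X(1)] \<phi>_G(1)[OF True] a jn, symmetric])
    also have "\<sigma> (sinv ?a) * X * \<phi> (?a * ?y) = \<sigma> (sinv ?a) * (\<sigma> (?a * ?y) * X)"
      unfolding X_G[OF True] using \<phi>_G[OF True] by (simp add: mat_mult_assoc)
    also have "\<dots> = \<sigma> (sinv ?a * (?a * ?y)) * X" by (simp add: mat_mult_assoc \<sigma>_mult)
    also have "sinv ?a * (?a * ?y) = ?y" by (rule translate_in_G_D(3)[OF p_fs(1)[OF c] y True])
    finally show ?thesis using True by (simp add: block_entry_def mult.assoc del: index_mult_mat(1))
  next
    case False
    then show ?thesis by (simp add: block_entry_def mult.assoc)
  qed
  have "(intertwiner * \<phi>_star_nu s) $$ (a, j) = (\<Sum>i<length fs * n. (\<sigma> (sinv (q i)) * X) $$ (a, i mod n) *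
      block_entry (\<lambda>g. \<phi> g $$ (i mod n, j mod n)) (q i) (q j) s)"
    unfolding mat_mult_entry[OF intertwiner_carrier assoc_rep_carrier(1) a j]
    by (rule sum.cong[OF refl]) (use a j in \<open>simp add: assoc_rep_entry intertwiner_def del: index_mult_mat(1)\<close>)
  also have "\<dots> = (\<Sum>c<length fs. \<Sum>r<n. (\<sigma> (sinv (p (fs ! c))) * X) $$ (a, r) *
      block_entry (\<lambda>g. \<phi> g $$ (r, j mod n)) (p (fs ! c)) (q j) s)"
    by (rule sum_div_mod)
  also have "\<dots> = (\<Sum>c<length fs. if p (fs ! c) * ?y \<in> G then ?V else 0)"
    by (rule sum.cong[OF refl]) (simp only: block lessThan_iff)
  also have "\<dots> = ?V"
  proof (cases "?y \<in> L_class")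
    case True
    then have "?y * sinv ?y \<in> set fs" unfolding fs(2) index_idems_eq by blast
    then obtain c0 where c0: "c0 < length fs" "fs ! c0 = ?y * sinv ?y" by (auto simp: in_set_conv_nth)
    have "p (fs ! c) * ?y \<in> G \<longleftrightarrow> c = c0" if c: "c < length fs" for c
    proof
      assume "p (fs ! c) * ?y \<in> G"
      from translate_in_G_D(2)[OF p_fs(1)[OF c] y this] have "fs ! c = fs ! c0" using p_fs(2)[OF c] c0 by simp
      then show "c = c0" using fs(1) c c0(1) by (simp add: nth_eq_iff_index_eq)
    next
      assume "c = c0"
      then show "p (fs ! c) * ?y \<in> G" using translate_in_G_I[OF True p_fs(1)[OF c]] p_fs(2)[OF c] c0 by simp
    qed
    then have "(\<Sum>c<length fs. if p (fs ! c) * ?y \<in> G then ?V else 0) = (\<Sum>c<length fs. if c = c0 then ?V else 0)"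
      by (intro sum.cong) auto
    then show ?thesis using c0(1) by (simp add: sum.delta del: index_mult_mat(1))
  next
    case False
    have "p (fs ! c) * ?y \<notin> G" if "c < length fs" for c
      using translate_in_G_D(1)[OF p_fs(1)[OF that] y] False by blast
    then have "(\<Sum>c<length fs. if p (fs ! c) * ?y \<in> G then ?V else 0) = 0" by (intro sum.neutral) auto
    moreover have "\<sigma> ?y * X = \<sigma> ?y * eta * X" using X(3) by (simp add: mat_mult_assoc)
    then have "\<sigma> ?y * X = 0\<^sub>m k n" unfolding kill_eta_outside_L_class[OF y False] using X by simp
    then have "?V = 0" using a jn by simp
    ultimately show ?thesis by simp
  qed
  finally show "(\<sigma> s * intertwiner) $$ (a, j) = (intertwiner * \<phi>_star_nu s) $$ (a, j)"
    unfolding mult_intertwiner_entry[OF \<sigma>_carrier(1) a j] by (simp add: \<sigma>_mult)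
qed (use assoc_rep_carrier[of s] in auto)

text \<open>Schur's argument: the kernel of \<open>X\<close> is \<open>G\<close>-invariant.\<close>

lemma X_injective:
  assumes "v \<in> carrier_vec n" "X *\<^sub>v v = 0\<^sub>v k"
  shows "v = 0\<^sub>v n"
proof -
  let ?K = "{v \<in> carrier_vec n. X *\<^sub>v v = 0\<^sub>v k}"
  have "\<forall>g\<in>G. \<forall>w\<in>?K. \<phi> g *\<^sub>v w \<in> ?K"
  proof (intro ballI)
    fix g w assume g: "g \<in> G" and w: "w \<in> ?K"
    have "X *\<^sub>v (\<phi> g *\<^sub>v w) = X * \<phi> g *\<^sub>v w" using X \<phi>_G(1)[OF g] w by simp
    also have "\<dots> = \<sigma> g *\<^sub>v (X *\<^sub>v w)" unfolding X_G[OF g, symmetric] using X w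
      by (intro assoc_mult_mat_vec[of _ k k _ n]) auto
    also have "\<dots> = 0\<^sub>v k" using w mult_zero_vec[OF \<sigma>_carrier(1)] by simp
    finally show "\<phi> g *\<^sub>v w \<in> ?K" using \<phi>_G(1)[OF g] w by auto
  qed
  then have "?K = {0\<^sub>v n} \<or> ?K = carrier_vec n"
    using \<phi> subspace_kernel[OF X(1)] by (simp add: irreducible_group_rep_def irreducible_rep_def)
  moreover have "?K \<noteq> carrier_vec n" using mat_eq_0_if_kills_vecs[OF X(1)] X(2) by blast
  ultimately show ?thesis using assms by blast
qed

text \<open>\<open>\<sigma>(\<eta> p\<^sub>f)\<close> times the intertwiner is \<open>X\<close> in the block of \<open>f\<close>, because \<open>p\<^sub>f p\<^sub>f\<inverse> = e\<close>. In any other block \<open>f'\<close> it is \<open>0\<close>, because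
  \<open>p\<^sub>f p\<^sub>f\<^sub>'\<inverse>\<close> is not in \<open>G\<close>.\<close>

lemma intertwiner_injective:
  assumes v: "v \<in> carrier_vec (length fs * n)" and Tv: "intertwiner *\<^sub>v v = 0\<^sub>v k"
  shows "v = 0\<^sub>v (length fs * n)"
proof -
  have zero: "v $ (c * n + r) = 0" if c: "c < length fs" and r: "r < n" for c r
  proof -
    let ?w = "vec n (\<lambda>r. v $ (c * n + r))" and ?a = "p (fs ! c)"
    let ?M = "eta * \<sigma> ?a"
    have M: "?M \<in> carrier_mat k k" by (rule mult_carrier_mat) auto
    note ca = R_class_D[OF p_fs(1)[OF c]]
    have MT: "(?M * intertwiner) $$ (x, j) = (if j div n = c then X $$ (x, j mod n) else 0)"
      if x: "x < k" and j: "j < length fs * n" for x j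
    proof -
      have jn: "j mod n < n" using n_pos by simp
      note cj = R_class_D[OF p_fs(1)[OF div_less[OF j]]]
      let ?b = "sinv (q j)"
      have e1: "?M * \<sigma> ?b * X = eta * \<sigma> (?a * ?b) * X" by (simp add: mat_mult_assoc \<sigma>_mult)
      show ?thesis
      proof (cases "j div n = c")
        case True
        then have "?a * ?b = e" using ca(2) by simp
        then have "?M * \<sigma> ?b * X = X" unfolding e1 using X(3) by (simp add: eta_e)
        then show ?thesis unfolding mult_intertwiner_entry[OF M x j] using True by simp
      next
        case False
        have "?a * ?b \<notin> G"
        proof
          assume "?a * ?b \<in> G"
          from translate_in_G_D(2)[OF p_fs(1)[OF c] cj(4) this]
          have "fs ! (j div n) = fs ! c"
            using p_fs(2)[OF c] p_fs(2)[OF div_less[OF j]] sinv_regular(2)[OF cj(1)] by simp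
          then show False using False fs(1) c div_less[OF j] by (simp add: nth_eq_iff_index_eq)
        qed
        then have "eta * \<sigma> (?a * ?b) = 0\<^sub>m k k"
          using ca cj by (intro eta_kill_nonunit) (simp_all add: mult.assoc)
        then have "?M * \<sigma> ?b * X = 0\<^sub>m k n" unfolding e1 using X by simp
        then show ?thesis unfolding mult_intertwiner_entry[OF M x j] using False x jn by simp
      qed
    qed
    have "X *\<^sub>v ?w = 0\<^sub>v k"
    proof (rule eq_vecI)
      fix x assume "x < dim_vec (0\<^sub>v k :: 'k vec)"
      then have x: "x < k" by simp
      have "(X *\<^sub>v ?w) $ x = (\<Sum>r<n. X $$ (x, r) * v $ (c * n + r))"
        using x by (simp add: scalar_prod_def lessThan_atLeast0)
      also have "\<dots> = (\<Sum>c'<length fs. \<Sum>r<n. if c' = c then X $$ (x, r) * v $ (c' * n + r) else 0)"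
        using c by (subst sum.swap) (simp add: sum.delta)
      also have "\<dots> = (\<Sum>j<length fs * n. if j div n = c then X $$ (x, j mod n) * v $ (j div n * n + j mod n) else 0)"
        by (rule sum_div_mod[symmetric])
      also have "\<dots> = (\<Sum>j<length fs * n. (?M * intertwiner) $$ (x, j) * v $ j)"
      proof (rule sum.cong[OF refl])
        fix j assume "j \<in> {..<length fs * n}"
        then show "(if j div n = c then X $$ (x, j mod n) * v $ (j div n * n + j mod n) else 0) = (?M * intertwiner) $$ (x, j) * v $ j"
          unfolding div_mult_mod_eq using MT[OF x, of j] by (simp del: index_mult_mat(1))
      qed
      also have "\<dots> = (?M * intertwiner *\<^sub>v v) $ x"
        using x v by (simp add: scalar_prod_def lessThan_atLeast0)
      also have "?M * intertwiner *\<^sub>v v = ?M *\<^sub>v (intertwiner *\<^sub>v v)" by (rule assoc_mult_mat_vec[OF M intertwiner_carrier v])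
      also have "\<dots> = 0\<^sub>v k" unfolding Tv by (rule mult_zero_vec[OF M])
      finally show "(X *\<^sub>v ?w) $ x = 0\<^sub>v k $ x" .
    qed simp
    then have "?w = 0\<^sub>v n" by (intro X_injective) auto
    moreover have "?w $ r = v $ (c * n + r)" using r by simp
    ultimately show ?thesis using r by simp
  qed
  have "v $ j = 0" if "j < length fs * n" for j
    using zero[OF div_less[OF that], of "j mod n"] n_pos by simp
  then show ?thesis using v by (intro eq_vecI) auto
qed

lemma intertwiner_surjective:
  assumes "w \<in> carrier_vec k"
  shows "\<exists>v\<in>carrier_vec (length fs * n). intertwiner *\<^sub>v v = w"
proof -
  let ?W = "{intertwiner *\<^sub>v v | v. v \<in> carrier_vec (length fs * n)}"
  have "\<forall>s\<in>UNIV. \<forall>w\<in>?W. \<sigma> s *\<^sub>v w \<in> ?W"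
  proof (intro ballI)
    fix s w assume "w \<in> ?W"
    then obtain v where v: "v \<in> carrier_vec (length fs * n)" "w = intertwiner *\<^sub>v v" by blast
    have "\<sigma> s *\<^sub>v w = \<sigma> s * intertwiner *\<^sub>v v"
      unfolding v(2) by (rule assoc_mult_mat_vec[OF \<sigma>_carrier(1) intertwiner_carrier v(1), symmetric])
    also have "\<dots> = intertwiner *\<^sub>v (\<phi>_star_nu s *\<^sub>v v)"
      unfolding intertwiner_commutes by (rule assoc_mult_mat_vec[OF intertwiner_carrier assoc_rep_carrier(1) v(1)])
    finally show "\<sigma> s *\<^sub>v w \<in> ?W" using mult_mat_vec_carrier[OF assoc_rep_carrier(1) v(1)] by blast
  qed
  then have "?W = {0\<^sub>v k} \<or> ?W = carrier_vec k"
    using irr subspace_image[OF intertwiner_carrier] unfolding irreducible_rep_def by blast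
  moreover have "?W \<noteq> {0\<^sub>v k}"
  proof
    assume W: "?W = {0\<^sub>v k}"
    have pos: "0 < length fs * n" using e_in_fs n_pos by (auto simp: length_pos_if_in_set)
    have "intertwiner *\<^sub>v unit_vec (length fs * n) 0 \<in> ?W" using unit_vec_carrier by blast
    then have "intertwiner *\<^sub>v unit_vec (length fs * n) 0 = 0\<^sub>v k" unfolding W by simp
    from intertwiner_injective[OF unit_vec_carrier this] have "unit_vec (length fs * n) 0 $ 0 = (0 :: 'k)"
      using pos by simp
    then show False using pos by simp
  qed
  ultimately have "w \<in> ?W" using assms by simp
  then show ?thesis by blast
qed

lemma equivalent: "equivalent_reps UNIV \<phi>_star_nu \<sigma>"
proof -
  obtain R where kk: "k = length fs * n" and R: "R \<in> carrier_mat (length fs * n) k"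
    and TR: "intertwiner * R = 1\<^sub>m k" and RT: "R * intertwiner = 1\<^sub>m (length fs * n)"
    by (rule inverse_of_bijective_mat[OF intertwiner_carrier intertwiner_injective intertwiner_surjective])
  have "similar_mat_wit (\<phi>_star_nu s) (\<sigma> s) R intertwiner" for s
  proof -
    have "R * \<sigma> s * intertwiner = R * (\<sigma> s * intertwiner)" using R by (simp add: mat_mult_assoc)
    also have "\<dots> = R * intertwiner * \<phi>_star_nu s" unfolding intertwiner_commutes
      using R assoc_rep_carrier[of s] by (simp add: mat_mult_assoc)
    also have "\<dots> = \<phi>_star_nu s" unfolding RT by simp
    finally show ?thesis using R TR RT kk assoc_rep_carrier[of s] intertwiner_carrier \<sigma>_carrier(1)[of s]
      by (intro similar_mat_witI[of _ _ k]) simp_all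
  qed
  then show ?thesis unfolding equivalent_reps_def by blast
qed

end

section \<open>The pairing and its value on irreducible characters\<close>

context commuting_idempotents_at
begin

text \<open>The right-hand side of the theorem as a functional of \<open>\<theta>\<close>.\<close>

definition moebius_pairing :: "('s \<Rightarrow> 'k) \<Rightarrow> ('s \<Rightarrow> 'k) \<Rightarrow> 'k::field_char_0" where
  "moebius_pairing \<chi> \<theta> = (\<Sum>f\<in>{f \<in> idems. idem_le f e}.
     char_inner G \<chi> (\<lambda>s. \<theta> (f * s)) * of_int (moebius idems idem_le f e))"

lemma card_G_nonzero: "of_nat (card G) \<noteq> (0::'k::field_char_0)"
  using G_e(1) by (simp add: card_eq_0_iff) blast

lemma moebius_pairing_eq:
  "moebius_pairing \<chi> \<theta> =
    (\<Sum>g\<in>G. \<chi> (sinv g) * (\<Sum>u\<in>UNIV. idem_coeff e u * \<theta> (u * g))) / of_nat (card G)"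
proof -
  have "moebius_pairing \<chi> \<theta> = (\<Sum>u\<in>UNIV. char_inner G \<chi> (\<lambda>s. \<theta> (u * s)) * idem_coeff e u)"
    unfolding moebius_pairing_def by (rule sum.mono_neutral_cong_left) (auto simp: idem_coeff_def)
  also have "\<dots> = (\<Sum>u\<in>UNIV. \<Sum>g\<in>G. \<chi> (sinv g) * (idem_coeff e u * \<theta> (u * g))) / of_nat (card G)"
    by (simp add: char_inner_def sum_divide_distrib sum_distrib_right sum_distrib_left ac_simps)
  also have "\<dots> = (\<Sum>g\<in>G. \<Sum>u\<in>UNIV. \<chi> (sinv g) * (idem_coeff e u * \<theta> (u * g))) / of_nat (card G)"
    by (subst sum.swap) (rule refl)
  finally show ?thesis by (simp add: sum_distrib_left)
qed

lemma moebius_pairing_add: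
  "moebius_pairing \<chi> (\<lambda>s. \<theta> s + \<theta>' s) = moebius_pairing \<chi> \<theta> + moebius_pairing \<chi> \<theta>'"
  unfolding moebius_pairing_eq by (simp add: distrib_left sum.distrib add_divide_distrib)

end

text \<open>
  For representations \<open>\<alpha>\<close>, \<open>\<beta>\<close> of a group \<open>G\<close> this is, up to the factor \<open>1 / card G\<close>, the average over \<open>G\<close> of
  \<open>\<alpha>(g) E \<beta>(g\<inverse>)\<close>, where \<open>E\<close> is the \<open>k \<times> n\<close> matrix unit at \<open>(i, j)\<close>.\<close>

definition averaged_unit ::
    "'s::semigroup_mult set \<Rightarrow> nat \<Rightarrow> nat \<Rightarrow> ('s \<Rightarrow> 'k::field mat) \<Rightarrow> ('s \<Rightarrow> 'k mat) \<Rightarrow> nat \<Rightarrow> nat \<Rightarrow> 'k mat" where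
  "averaged_unit G k n \<alpha> \<beta> i j = mat k n (\<lambda>(a, b). \<Sum>g\<in>G. \<alpha> g $$ (a, i) * \<beta> (sinv g) $$ (j, b))"

context commuting_idempotents_at
begin

lemma averaged_unit_intertwines:
  fixes \<alpha> \<beta> :: "'s \<Rightarrow> 'k::field mat"
  assumes \<alpha>: "mat_rep G k \<alpha>" and \<beta>: "mat_rep G n \<beta>" and ij: "i < k" "j < n" and h: "h \<in> G"
  shows "\<alpha> h * averaged_unit G k n \<alpha> \<beta> i j = averaged_unit G k n \<alpha> \<beta> i j * \<beta> h"
proof (rule eq_matI)
  have \<alpha>: "\<And>g. g \<in> G \<Longrightarrow> \<alpha> g \<in> carrier_mat k k" "\<And>g. g \<in> G \<Longrightarrow> \<alpha> (h * g) = \<alpha> h * \<alpha> g"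
    and \<beta>: "\<And>g. g \<in> G \<Longrightarrow> \<beta> g \<in> carrier_mat n n" "\<And>g. g \<in> G \<Longrightarrow> \<beta> (g * h) = \<beta> g * \<beta> h"
    using \<alpha> \<beta> h by (auto simp: mat_rep_def)
  let ?P = "averaged_unit G k n \<alpha> \<beta> i j"
  have P: "?P \<in> carrier_mat k n" by (simp add: averaged_unit_def)
  fix a b assume "a < dim_row (?P * \<beta> h)" "b < dim_col (?P * \<beta> h)"
  then have ab: "a < k" "b < n" using P \<beta>(1)[OF h] by auto
  have "(\<alpha> h * ?P) $$ (a, b) = (\<Sum>x<k. \<Sum>g\<in>G. \<alpha> h $$ (a, x) * \<alpha> g $$ (x, i) * \<beta> (sinv g) $$ (j, b))"
    unfolding mat_mult_entry[OF \<alpha>(1)[OF h] P ab]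
    by (rule sum.cong[OF refl]) (use ab in \<open>simp add: averaged_unit_def sum_distrib_left mult.assoc\<close>)
  also have "\<dots> = (\<Sum>g\<in>G. \<Sum>x<k. \<alpha> h $$ (a, x) * \<alpha> g $$ (x, i) * \<beta> (sinv g) $$ (j, b))" by (rule sum.swap)
  also have "\<dots> = (\<Sum>g\<in>G. \<alpha> (h * g) $$ (a, i) * \<beta> (sinv (h * g) * h) $$ (j, b))"
  proof (rule sum.cong[OF refl])
    fix g assume g: "g \<in> G"
    have "sinv (h * g) * h = sinv g"
      using G_mult(2)[OF h g] G_D[OF h] G_D[OF g] by (simp add: mult.assoc)
    then show "(\<Sum>x<k. \<alpha> h $$ (a, x) * \<alpha> g $$ (x, i) * \<beta> (sinv g) $$ (j, b)) =
        \<alpha> (h * g) $$ (a, i) * \<beta> (sinv (h * g) * h) $$ (j, b)"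
      by (simp only: \<alpha>(2)[OF g] mat_mult_entry[OF \<alpha>(1)[OF h] \<alpha>(1)[OF g] ab(1) ij(1)] sum_distrib_right)
  qed
  \<comment> \<open>The substitution of \<open>h * g\<close> for \<open>g\<close> moves \<open>h\<close> to the other side.\<close>
  also have "\<dots> = (\<Sum>g\<in>G. \<alpha> g $$ (a, i) * \<beta> (sinv g * h) $$ (j, b))"
    by (rule sum.reindex_bij_betw[OF bij_mult_G[OF h]])
  also have "\<dots> = (\<Sum>g\<in>G. \<Sum>y<n. \<alpha> g $$ (a, i) * \<beta> (sinv g) $$ (j, y) * \<beta> h $$ (y, b))"
    by (rule sum.cong[OF refl])
      (simp only: \<beta>(2)[OF G_sinv(1)] mat_mult_entry[OF \<beta>(1)[OF G_sinv(1)] \<beta>(1)[OF h] ij(2) ab(2)] sum_distrib_left mult.assoc)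
  also have "\<dots> = (\<Sum>y<n. \<Sum>g\<in>G. \<alpha> g $$ (a, i) * \<beta> (sinv g) $$ (j, y) * \<beta> h $$ (y, b))" by (rule sum.swap)
  also have "\<dots> = (?P * \<beta> h) $$ (a, b)"
    unfolding mat_mult_entry[OF P \<beta>(1)[OF h] ab]
    by (rule sum.cong[OF refl]) (use ab in \<open>simp add: averaged_unit_def sum_distrib_right\<close>)
  finally show "(\<alpha> h * ?P) $$ (a, b) = (?P * \<beta> h) $$ (a, b)" .
next
  have "\<alpha> h \<in> carrier_mat k k" "\<beta> h \<in> carrier_mat n n" using assms by (auto simp: mat_rep_def)
  then show "dim_row (\<alpha> h * averaged_unit G k n \<alpha> \<beta> i j) = dim_row (averaged_unit G k n \<alpha> \<beta> i j * \<beta> h)"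
    "dim_col (\<alpha> h * averaged_unit G k n \<alpha> \<beta> i j) = dim_col (averaged_unit G k n \<alpha> \<beta> i j * \<beta> h)"
    by (auto simp: averaged_unit_def)
qed

text \<open>The trace of the averaging operator on \<open>k \<times> n\<close> matrices is the inner product of the two characters, again
  up to the factor \<open>1 / card G\<close>.\<close>

lemma averaged_unit_trace:
  fixes \<alpha> \<beta> :: "'s \<Rightarrow> 'k::field mat"
  assumes \<alpha>: "mat_rep G k \<alpha>" and \<beta>: "mat_rep G n \<beta>"
  shows "(\<Sum>g\<in>G. mat_trace (\<beta> (sinv g)) * mat_trace (\<alpha> g)) =
    (\<Sum>i<k. \<Sum>j<n. averaged_unit G k n \<alpha> \<beta> i j $$ (i, j))"
proof -
  have dim: "dim_row (\<alpha> g) = k" "dim_row (\<beta> (sinv g)) = n" if "g \<in> G" for g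
    using \<alpha> \<beta> that G_sinv(1)[OF that] by (auto simp: mat_rep_def)
  have "(\<Sum>g\<in>G. mat_trace (\<beta> (sinv g)) * mat_trace (\<alpha> g)) =
      (\<Sum>g\<in>G. \<Sum>i<k. \<Sum>j<n. \<alpha> g $$ (i, i) * \<beta> (sinv g) $$ (j, j))"
    by (rule sum.cong[OF refl]) (simp add: mat_trace_def dim sum_product mult.commute)
  also have "\<dots> = (\<Sum>i<k. \<Sum>g\<in>G. \<Sum>j<n. \<alpha> g $$ (i, i) * \<beta> (sinv g) $$ (j, j))" by (rule sum.swap)
  also have "\<dots> = (\<Sum>i<k. \<Sum>j<n. \<Sum>g\<in>G. \<alpha> g $$ (i, i) * \<beta> (sinv g) $$ (j, j))"
    by (rule sum.cong[OF refl], rule sum.swap)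
  finally show ?thesis by (simp add: averaged_unit_def)
qed

text \<open>Averaging is a projection onto the matrices commuting with \<open>\<phi>\<close>, so its trace \<open>(\<chi>,\<chi>)\<^sub>G\<close> is the dimension of
  the endomorphism algebra.\<close>

lemma endo_dim_eq:
  fixes \<phi> :: "'s \<Rightarrow> 'k::field_char_0 mat"
  assumes \<phi>: "mat_rep G n \<phi>" and \<phi>e: "\<phi> e = 1\<^sub>m n"
  shows "(\<Sum>g\<in>G. mat_trace (\<phi> (sinv g)) * mat_trace (\<phi> g)) = of_nat (card G) * of_nat (endo_dim G n \<phi>)"
proof -
  let ?D = "{M \<in> carrier_mat n n. \<forall>g\<in>G. M * \<phi> g = \<phi> g * M}"
  let ?N = "of_nat (card G) :: 'k"
  define P where "P i j = (1 / ?N) \<cdot>\<^sub>m averaged_unit G n n \<phi> \<phi> i j" for i j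
  have \<phi>c: "\<phi> g \<in> carrier_mat n n" if "g \<in> G" for g using \<phi> that by (simp add: mat_rep_def)
  have av: "averaged_unit G n n \<phi> \<phi> i j \<in> carrier_mat n n" for i j by (simp add: averaged_unit_def)
  have "of_nat (endo_dim G n \<phi>) = (\<Sum>i<n. \<Sum>j<n. P i j $$ (i, j))"
    unfolding endo_dim_def
  proof (rule dim_eq_trace_of_projection)
    show "subspace class_ring ?D (module_mat TYPE('k) n n)"
      by (rule subspaceI_mat)
        (use \<phi>c in \<open>auto simp: left_mult_zero_mat[of _ n n] right_mult_zero_mat[of _ n n] add_mult_distrib_mat[of _ n n _ _ n] mult_add_distrib_mat[of _ n n _ n]
          mult_smult_assoc_mat[of _ n n _ n] mult_smult_distrib[of _ n n _ n]\<close>)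
    show "P i j \<in> ?D" if "i < n" "j < n" for i j
      using averaged_unit_intertwines[OF \<phi> \<phi> that] \<phi>c av[of i j]
      by (simp add: P_def mult_smult_assoc_mat[of _ n n _ n] mult_smult_distrib[of _ n n _ n])
    fix M a b assume M: "M \<in> ?D" and ab: "a < n" "b < n"
    have M_fix: "(\<phi> g * M * \<phi> (sinv g)) $$ (a, b) = M $$ (a, b)" if g: "g \<in> G" for g
    proof -
      have g': "sinv g \<in> G" by (rule G_sinv[OF g])
      have "\<phi> g * M * \<phi> (sinv g) = M * \<phi> g * \<phi> (sinv g)" using M g by simp
      also have "\<dots> = M * (\<phi> g * \<phi> (sinv g))" using M \<phi>c[OF g] \<phi>c[OF g']
        by (intro assoc_mult_mat[of _ n n _ n _ n]) auto
      also have "\<phi> g * \<phi> (sinv g) = \<phi> (g * sinv g)" using \<phi> g g' by (simp add: mat_rep_def)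
      also have "\<dots> = 1\<^sub>m n" using \<phi>e G_D[OF g] by simp
      finally show ?thesis using M by (simp add: right_mult_one_mat[of M n n] del: index_mult_mat(1))
    qed
    have entry: "(\<phi> g * M * \<phi> (sinv g)) $$ (a, b) =
        (\<Sum>i<n. \<Sum>j<n. M $$ (i, j) * (\<phi> g $$ (a, i) * \<phi> (sinv g) $$ (j, b)))" if g: "g \<in> G" for g
    proof -
      have M: "M \<in> carrier_mat n n" using M by simp
      have "(\<phi> g * M * \<phi> (sinv g)) $$ (a, b) =
          (\<Sum>j<n. \<Sum>i<n. \<phi> g $$ (a, i) * M $$ (i, j) * \<phi> (sinv g) $$ (j, b))"
        unfolding mat_mult_entry[OF mult_carrier_mat[OF \<phi>c[OF g] M] \<phi>c[OF G_sinv(1)[OF g]] ab]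
        by (rule sum.cong[OF refl]) (simp only: mat_mult_entry[OF \<phi>c[OF g] M ab(1)] sum_distrib_right lessThan_iff)
      also have "\<dots> = (\<Sum>i<n. \<Sum>j<n. \<phi> g $$ (a, i) * M $$ (i, j) * \<phi> (sinv g) $$ (j, b))" by (rule sum.swap)
      finally show ?thesis by (simp only: ac_simps)
    qed
    have "?N * M $$ (a, b) = (\<Sum>g\<in>G. (\<phi> g * M * \<phi> (sinv g)) $$ (a, b))" using M_fix by simp
    also have "\<dots> = (\<Sum>g\<in>G. \<Sum>i<n. \<Sum>j<n. M $$ (i, j) * (\<phi> g $$ (a, i) * \<phi> (sinv g) $$ (j, b)))"
      by (rule sum.cong[OF refl]) (rule entry)
    also have "\<dots> = (\<Sum>i<n. \<Sum>g\<in>G. \<Sum>j<n. M $$ (i, j) * (\<phi> g $$ (a, i) * \<phi> (sinv g) $$ (j, b)))"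
      by (rule sum.swap)
    also have "\<dots> = (\<Sum>i<n. \<Sum>j<n. \<Sum>g\<in>G. M $$ (i, j) * (\<phi> g $$ (a, i) * \<phi> (sinv g) $$ (j, b)))"
      by (rule sum.cong[OF refl], rule sum.swap)
    also have "\<dots> = (\<Sum>i<n. \<Sum>j<n. M $$ (i, j) * (?N * P i j $$ (a, b)))"
      using ab card_G_nonzero[where 'k='k] by (simp add: P_def averaged_unit_def sum_distrib_left)
    also have "\<dots> = ?N * (\<Sum>i<n. \<Sum>j<n. M $$ (i, j) * P i j $$ (a, b))"
      by (simp add: sum_distrib_left ac_simps)
    finally show "M $$ (a, b) = (\<Sum>i<n. \<Sum>j<n. M $$ (i, j) * P i j $$ (a, b))"
      using card_G_nonzero[where 'k='k] by simp
  qed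
  also have "\<dots> = (\<Sum>i<n. \<Sum>j<n. averaged_unit G n n \<phi> \<phi> i j $$ (i, j)) / ?N"
    using av by (simp add: P_def averaged_unit_def sum_divide_distrib)
  finally show ?thesis unfolding averaged_unit_trace[OF \<phi> \<phi>] using card_G_nonzero[where 'k='k] by simp
qed

end

context representation_at
begin

lemma trace_eta_mult:
  "mat_trace (eta * \<sigma> g) = (\<Sum>u\<in>UNIV. idem_coeff e u * mat_trace (\<sigma> (u * g)))"
proof -
  have "mat_trace (eta * \<sigma> g) = (\<Sum>i<k. \<Sum>u\<in>UNIV. idem_coeff e u * \<sigma> (u * g) $$ (i, i))"
    unfolding mat_trace_def
  proof (rule sum.cong)
    fix i assume "i \<in> {..<k}"
    then have i: "i < k" by simp
    from sandwich_eta[OF one_carrier_mat \<sigma>_carrier(1) i i, of g]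
    show "(eta * \<sigma> g) $$ (i, i) = (\<Sum>u\<in>UNIV. idem_coeff e u * \<sigma> (u * g) $$ (i, i))"
      by (simp add: \<sigma>_mult del: index_mult_mat(1))
  qed simp
  also have "\<dots> = (\<Sum>u\<in>UNIV. \<Sum>i<k. idem_coeff e u * \<sigma> (u * g) $$ (i, i))" by (rule sum.swap)
  finally show ?thesis by (simp add: mat_trace_def sum_distrib_left)
qed

lemma moebius_pairing_trace:
  "moebius_pairing \<chi> (\<lambda>s. mat_trace (\<sigma> s)) = (\<Sum>g\<in>G. \<chi> (sinv g) * mat_trace (eta * \<sigma> g)) / of_nat (card G)"
  unfolding moebius_pairing_eq trace_eta_mult ..

text \<open>The action of \<open>G\<close> on \<open>\<eta>V\<close>, extended by zero to a complement.\<close>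

lemma eta_rep: "mat_rep G k (\<lambda>g. eta * \<sigma> g)"
proof -
  have "eta * \<sigma> (g * h) = eta * \<sigma> g * (eta * \<sigma> h)" if "g \<in> G" for g h
  proof -
    have "eta * \<sigma> g * (eta * \<sigma> h) = eta * (\<sigma> g * eta) * \<sigma> h" by (simp add: mat_mult_assoc)
    also have "\<dots> = (eta * eta) * (\<sigma> g * \<sigma> h)" unfolding eta_commutes[OF that] by (simp add: mat_mult_assoc)
    finally show ?thesis by (simp add: eta_idem \<sigma>_mult)
  qed
  moreover have "eta * \<sigma> g \<in> carrier_mat k k" for g by (rule mult_carrier_mat) auto
  ultimately show ?thesis by (simp add: mat_rep_def)
qed

end

context associated_representation
begin

lemma \<phi>_rep: "mat_rep G n \<phi>"
  using \<phi> by (simp add: irreducible_group_rep_def irreducible_rep_def)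

text \<open>The pairing is, up to a nonzero factor, the trace of the averaging operator from \<open>V\<^sub>\<phi>\<close> to \<open>\<eta>V\<close>. If it is
  nonzero, some average of a matrix unit is nonzero, and this is a suitable \<open>X\<close>.\<close>

lemma pairing_nonzero_equivalent:
  assumes \<chi>: "\<And>g. g \<in> G \<Longrightarrow> \<chi> g = mat_trace (\<phi> g)"
    and irr: "irreducible_rep UNIV k \<sigma>" and nz: "moebius_pairing \<chi> (\<lambda>s. mat_trace (\<sigma> s)) \<noteq> 0"
  shows "equivalent_reps UNIV \<phi>_star_nu \<sigma>"
proof -
  interpret \<sigma>: irreducible_representation_at e k \<sigma>
    using irr by unfold_locales (auto simp: irreducible_rep_def)
  let ?\<alpha> = "\<lambda>g. \<sigma>.eta * \<sigma> g"
  have "(\<Sum>g\<in>G. mat_trace (\<phi> (sinv g)) * mat_trace (?\<alpha> g)) = (\<Sum>g\<in>G. \<chi> (sinv g) * mat_trace (?\<alpha> g))"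
    by (rule sum.cong[OF refl]) (simp add: \<chi> G_sinv(1))
  also have "\<dots> \<noteq> 0" using nz unfolding \<sigma>.moebius_pairing_trace by auto
  finally have "(\<Sum>i<k. \<Sum>j<n. averaged_unit G k n ?\<alpha> \<phi> i j $$ (i, j)) \<noteq> 0"
    unfolding averaged_unit_trace[OF \<sigma>.eta_rep \<phi>_rep] .
  then obtain i j where ij: "i < k" "j < n" and ne: "averaged_unit G k n ?\<alpha> \<phi> i j $$ (i, j) \<noteq> 0"
    by (meson sum.not_neutral_contains_not_neutral lessThan_iff)
  define X where "X = averaged_unit G k n ?\<alpha> \<phi> i j"
  have X: "X \<in> carrier_mat k n" by (simp add: X_def averaged_unit_def)
  note int = averaged_unit_intertwines[OF \<sigma>.eta_rep \<phi>_rep ij, folded X_def]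
  have eX: "\<sigma>.eta * X = X" using int[OF G_e(1)] X by (simp add: \<sigma>.eta_e \<phi>_e)
  have GX: "\<sigma> g * X = X * \<phi> g" if g: "g \<in> G" for g
  proof -
    have "\<sigma> g * X = \<sigma> g * \<sigma>.eta * X" using X eX by (simp add: mat_mult_assoc)
    then show ?thesis using int[OF g] \<sigma>.eta_commutes[OF g] by simp
  qed
  interpret comparison e n \<phi> p fs k \<sigma> X
    by unfold_locales (use X eX GX ne ij in \<open>auto simp: X_def\<close>)
  show ?thesis by (rule equivalent)
qed

text \<open>Here \<open>\<eta>\<close> acts on the associated representation as the projection onto the block of \<open>e\<close>: its diagonal block at \<open>f\<close> is
  the sum of \<open>\<mu>(u,e)\<close> over \<open>f \<le> u \<le> e\<close> times the identity. On that block \<open>g \<in> G\<close> acts by \<open>\<phi>(p\<^sub>e g p\<^sub>e\<inverse>)\<close>, and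
  \<open>p\<^sub>e \<in> G\<close>, so the pairing is \<open>(\<chi>,\<chi>)\<^sub>G\<close>.\<close>

lemma pairing_equivalent:
  assumes \<chi>: "\<And>g. g \<in> G \<Longrightarrow> \<chi> g = mat_trace (\<phi> g)"
    and rep: "mat_rep UNIV k \<sigma>" and eq: "equivalent_reps UNIV \<phi>_star_nu \<sigma>"
  shows "moebius_pairing \<chi> (\<lambda>s. mat_trace (\<sigma> s)) = of_nat (endo_dim G n \<phi>)"
proof -
  obtain P Q where PQ: "\<And>s. similar_mat_wit (\<phi>_star_nu s) (\<sigma> s) P Q"
    using eq by (auto simp: equivalent_reps_def)
  have tr: "mat_trace (\<sigma> s) = mat_trace (\<phi>_star_nu s)" for s using trace_similar[OF PQ] by simp
  let ?N = "length fs * n"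
  \<comment> \<open>Multiplicativity of the associated representation is inherited from \<open>\<sigma>\<close> by equivalence.\<close>
  have "mat_rep UNIV ?N \<phi>_star_nu"
    unfolding mat_rep_def
  proof (intro conjI ballI)
    fix s t
    have c: "P \<in> carrier_mat ?N ?N" "Q \<in> carrier_mat ?N ?N" "Q * P = 1\<^sub>m ?N" "\<sigma> u \<in> carrier_mat ?N ?N"
      "\<phi>_star_nu u = P * \<sigma> u * Q" for u
      using similar_mat_witD[OF assoc_rep_carrier(2)[symmetric, of u] PQ[of u]] by auto
    have "\<phi>_star_nu s * \<phi>_star_nu t = P * \<sigma> s * (Q * P) * \<sigma> t * Q"
      unfolding c(5)[of s] c(5)[of t] using c(1,2) c(4)[of s] c(4)[of t] by (simp add: mat_mult_assoc)
    also have "\<dots> = P * \<sigma> (s * t) * Q"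
      unfolding c(3) using c(1,2) c(4)[of s] c(4)[of t] rep by (simp add: mat_mult_assoc mat_rep_def)
    finally show "\<phi>_star_nu (s * t) = \<phi>_star_nu s * \<phi>_star_nu t" using c(5) by simp
  qed auto
  then interpret S: representation_at e ?N \<phi>_star_nu
    by unfold_locales
  obtain c0 where c0: "c0 < length fs" "fs ! c0 = e" using e_in_fs by (auto simp: in_set_conv_nth)
  let ?a = "p e"
  have a: "?a \<in> G" using p_fs[OF c0(1)] c0(2) by (auto simp: R_class_def max_subgroup_def)
  have ix: "fs ! c = e \<longleftrightarrow> c = c0" if "c < length fs" for c
    using fs(1) that c0 by (metis nth_eq_iff_index_eq)
  \<comment> \<open>\<open>\<eta>\<close> acts as the identity on the block of \<open>e\<close>, which has number \<open>c0\<close>, and as zero on the other blocks.\<close>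
  have eta: "S.eta $$ (i, j) = (if i = j \<and> i div n = c0 then 1 else 0)" if i: "i < ?N" and j: "j < ?N" for i j
  proof -
    note pi = p_fs[OF div_less[OF i]] and pj = p_fs[OF div_less[OF j]]
    note Pi = R_class_D[OF pi(1)]
    have f: "fs ! (i div n) \<in> idems" using Pi(9) pi(2) by simp
    have same: "fs ! (i div n) = fs ! (j div n) \<longleftrightarrow> i div n = j div n"
      using fs(1) div_less[OF i] div_less[OF j] by (simp add: nth_eq_iff_index_eq)
    have ent: "\<phi>_star_nu u $$ (i, j) = (if idem_le (fs ! (i div n)) u \<and> i = j then 1 else 0)" if u: "u \<in> idems" for u
    proof (cases "i div n = j div n")
      case True
      have n: "i mod n < n" "j mod n < n" using n_pos by auto
      have ij: "i mod n = j mod n \<longleftrightarrow> i = j" using True by (metis div_mult_mod_eq)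
      let ?b = "p (fs ! (i div n))"
      have iff: "?b * u * sinv ?b \<in> G \<longleftrightarrow> idem_le (fs ! (i div n)) u"
        using idem_translate_in_G_iff[OF pi(1) pi(1) u] pi(2) Pi(2) G_e(1) by simp
      moreover have "?b * u * sinv ?b = e" if "idem_le (fs ! (i div n)) u"
      proof -
        have "?b * u = ?b * (sinv ?b * ?b * u)" using Pi(8) by (metis mult.assoc)
        also have "\<dots> = ?b" using that pi(2) Pi(8) by (simp add: idem_le_def)
        finally show ?thesis using Pi(2) by simp
      qed
      ultimately show ?thesis
        unfolding assoc_rep_entry[OF i j] using True n ij by (auto simp: block_entry_def \<phi>_e)
    next
      case False
      then show ?thesis
        unfolding assoc_rep_entry[OF i j]
        using idem_translate_in_G_iff[OF pi(1) pj(1) u] pi(2) pj(2) same by (auto simp: block_entry_def)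
    qed
    have "S.eta $$ (i, j) = (1\<^sub>m ?N * S.eta * 1\<^sub>m ?N) $$ (i, j)" by simp
    also have "\<dots> = (\<Sum>u\<in>UNIV. idem_coeff e u * \<phi>_star_nu u $$ (i, j))"
      unfolding S.sandwich_eta[OF one_carrier_mat one_carrier_mat i j] by simp
    also have "\<dots> = (\<Sum>u\<in>UNIV. if idem_le (fs ! (i div n)) u then (if i = j then idem_coeff e u else 0) else 0)"
      by (rule sum.cong[OF refl]) (use ent in \<open>auto simp: idem_coeff_def\<close>)
    also have "\<dots> = (if i = j then (\<Sum>u\<in>{u. idem_le (fs ! (i div n)) u}. idem_coeff e u) else 0)"
      by (auto simp: sum.If_cases)
    finally show ?thesis unfolding idem_coeff_upper_sum[OF f] ix[OF div_less[OF i]] by simp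
  qed
  have "mat_trace (S.eta * \<phi>_star_nu g) = \<chi> g" if g: "g \<in> G" for g
  proof -
    have conj: "?a * g * sinv ?a \<in> G" using a g G_mult(1) G_sinv(1) by blast
    have "mat_trace (S.eta * \<phi>_star_nu g) = (\<Sum>i<?N. (S.eta * \<phi>_star_nu g) $$ (i, i))"
      by (simp add: mat_trace_def)
    also have "\<dots> = (\<Sum>i<?N. if i div n = c0 then \<phi> (?a * g * sinv ?a) $$ (i mod n, i mod n) else 0)"
    proof (rule sum.cong[OF refl])
      fix i assume "i \<in> {..<?N}"
      then have i: "i < ?N" by simp
      have "(S.eta * \<phi>_star_nu g) $$ (i, i) = (\<Sum>x<?N. S.eta $$ (i, x) * \<phi>_star_nu g $$ (x, i))"
        by (rule mat_mult_entry[OF S.eta_carrier(1) assoc_rep_carrier(1) i i])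
      also have "\<dots> = (\<Sum>x<?N. if x = i then (if i div n = c0 then \<phi>_star_nu g $$ (i, i) else 0) else 0)"
        by (rule sum.cong[OF refl]) (use i in \<open>auto simp: eta\<close>)
      also have "\<dots> = (if i div n = c0 then \<phi>_star_nu g $$ (i, i) else 0)"
        using i by (simp add: sum.delta)
      finally show "(S.eta * \<phi>_star_nu g) $$ (i, i) =
          (if i div n = c0 then \<phi> (?a * g * sinv ?a) $$ (i mod n, i mod n) else 0)"
        using conj c0(2) by (simp add: assoc_rep_entry[OF i i] block_entry_def del: index_mult_mat(1))
    qed
    also have "\<dots> = (\<Sum>c<length fs. \<Sum>r<n. if c = c0 then \<phi> (?a * g * sinv ?a) $$ (r, r) else 0)"
      by (rule sum_div_mod)
    also have "\<dots> = (\<Sum>r<n. \<phi> (?a * g * sinv ?a) $$ (r, r))"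
      using c0(1) by (subst sum.swap) (simp add: sum.delta)
    also have "\<dots> = mat_trace (\<phi> (?a * g * sinv ?a))" using \<phi>_G(2)[OF conj] by (simp add: mat_trace_def)
    also have "\<phi> (?a * g * sinv ?a) = \<phi> ?a * \<phi> (g * sinv ?a)"
      unfolding mult.assoc using a g G_mult(1) G_sinv(1) by (intro \<phi>_G(4)) blast+
    also have "mat_trace \<dots> = mat_trace (\<phi> (g * sinv ?a) * \<phi> ?a)"
      using a g G_mult(1) G_sinv(1) by (intro trace_mult_commute[of _ n n] \<phi>_G(1)) blast+
    also have "\<phi> (g * sinv ?a) * \<phi> ?a = \<phi> (g * sinv ?a * ?a)"
      using a g G_mult(1) G_sinv(1) by (intro \<phi>_G(4)[symmetric]) blast+
    also have "g * sinv ?a * ?a = g" using G_D(3)[OF a] G_D(5)[OF g] by (simp add: mult.assoc)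
    finally show ?thesis using \<chi>[OF g] by simp
  qed
  then have "moebius_pairing \<chi> (\<lambda>s. mat_trace (\<sigma> s)) = (\<Sum>g\<in>G. \<chi> (sinv g) * \<chi> g) / of_nat (card G)"
    unfolding tr S.moebius_pairing_trace by simp
  also have "(\<Sum>g\<in>G. \<chi> (sinv g) * \<chi> g) = (\<Sum>g\<in>G. mat_trace (\<phi> (sinv g)) * mat_trace (\<phi> g))"
    by (rule sum.cong[OF refl]) (simp add: \<chi> G_sinv(1))
  also have "\<dots> / of_nat (card G) = of_nat (endo_dim G n \<phi>)"
    unfolding endo_dim_eq[OF \<phi>_rep \<phi>_e] using card_G_nonzero[where 'k='k] by simp
  finally show ?thesis .
qed

lemma pairing_composition_factors:
  assumes \<chi>: "\<And>g. g \<in> G \<Longrightarrow> \<chi> g = mat_trace (\<phi> g)"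
    and "composition_factors N \<rho> \<sigma>s"
  shows "moebius_pairing \<chi> (\<lambda>s. mat_trace (\<rho> s)) =
    of_nat (length (filter (equivalent_reps UNIV \<phi>_star_nu) \<sigma>s) * endo_dim G n \<phi>)"
  using assms(2)
proof (induction rule: composition_factors.induct)
  case (Nil \<rho>)
  then have "\<rho> s \<in> carrier_mat 0 0" for s unfolding mat_rep_def by blast
  then have "dim_row (\<rho> s) = 0" for s by (rule carrier_matD(1))
  then have "mat_trace (\<rho> s) = 0" for s by (simp add: mat_trace_def)
  then show ?case by (simp add: moebius_pairing_eq)
next
  case (Cons k l \<rho> \<sigma> \<tau> \<sigma>s \<beta>)
  have \<tau>: "mat_rep UNIV l \<tau>" using Cons.hyps(3) by (cases rule: composition_factors.cases) auto
  have \<sigma>: "mat_rep UNIV k \<sigma>" using Cons.hyps(2) by (simp add: irreducible_rep_def)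
  have "mat_trace (\<rho> s) = mat_trace (\<sigma> s) + mat_trace (\<tau> s)" for s
  proof -
    obtain P Q where "similar_mat_wit (\<rho> s) (four_block_mat (\<sigma> s) (\<beta> s) (0\<^sub>m l k) (\<tau> s)) P Q"
      using Cons.hyps(5) by (auto simp: equivalent_reps_def)
    from trace_similar[OF this] show ?thesis
      using trace_four_block[of "\<sigma> s" k "\<tau> s" l] \<sigma> \<tau> by (simp add: mat_rep_def)
  qed
  then have "moebius_pairing \<chi> (\<lambda>s. mat_trace (\<rho> s)) =
      moebius_pairing \<chi> (\<lambda>s. mat_trace (\<sigma> s)) + moebius_pairing \<chi> (\<lambda>s. mat_trace (\<tau> s))"
    by (simp add: moebius_pairing_add)
  also have "moebius_pairing \<chi> (\<lambda>s. mat_trace (\<sigma> s)) =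
      (if equivalent_reps UNIV \<phi>_star_nu \<sigma> then of_nat (endo_dim G n \<phi>) else 0)"
    using pairing_equivalent[OF \<chi> \<sigma>] pairing_nonzero_equivalent[OF \<chi> Cons.hyps(2)] by auto
  finally show ?case using Cons.IH by (simp add: distrib_right)
qed

end

theorem theorem8p7:
  fixes e :: "'s::{semigroup_mult,finite}"
    and \<chi> \<theta> :: "'s \<Rightarrow> 'k::field_char_0"
    and \<phi> :: "'s \<Rightarrow> 'k mat"
    and n d m :: nat
    and p :: "'s \<Rightarrow> 's" and fs :: "'s list"
  assumes commuting_idempotents: "\<And>x y :: 's. x \<in> idems \<Longrightarrow> y \<in> idems \<Longrightarrow> x * y = y * x"
    and "e \<in> idems"
    and "irreducible_group_rep e n \<phi>"
    and "\<And>g. g \<in> max_subgroup e \<Longrightarrow> \<chi> g = mat_trace (\<phi> g)"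
    and "d = endo_dim (max_subgroup e) n \<phi>"
    and "\<And>f. f \<in> index_idems e \<Longrightarrow> p f \<in> regulars \<and> p f * sinv (p f) = e \<and> sinv (p f) * p f = f"
    and "distinct fs" and "set fs = index_idems e"
    and "is_character \<theta>"
    and "is_multiplicity (assoc_rep n \<phi> p fs) \<theta> m"
  shows "of_nat (m * d) =
    (\<Sum>f\<in>{f \<in> idems. idem_le f e}.
       char_inner (max_subgroup e) \<chi> (\<lambda>s. \<theta> (f * s)) * of_int (moebius idems idem_le f e))"
proof -
  interpret associated_representation e n \<phi> p fs
    by unfold_locales (use assms in blast)+
  obtain N \<rho> \<sigma>s where \<theta>: "\<And>s. \<theta> s = mat_trace (\<rho> s)" and cf: "composition_factors N \<rho> \<sigma>s"
    and m: "m = length (filter (equivalent_reps UNIV (assoc_rep n \<phi> p fs)) \<sigma>s)"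
    using assms(10) unfolding is_multiplicity_def by blast
  have "\<theta> = (\<lambda>s. mat_trace (\<rho> s))" using \<theta> by (rule ext)
  then have "moebius_pairing \<chi> \<theta> = of_nat (m * d)"
    using pairing_composition_factors[OF assms(4) cf] m assms(5) by simp
  then show ?thesis by (simp add: moebius_pairing_def)
qed

end
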